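(* Let $\Gamma$ be a cardinal number and $X$ be a Banach space. Then: (i) if $X$ has the $\bigl(2^\Gamma\bigr)^+$-$\mathsf{SVM}$ property, then the pair $(\ell_\infty(\Gamma),X)$ splits; (ii) if $X$ has the $\Gamma^+$-$\mathsf{SVM}$ property, then the pair $(c_0(\Gamma),X)$ splits.
   Context: All spaces are real. $\kappa^+$ denotes the cardinal successor of $\kappa$. A set algebra is a family $\mathscr{F}$ of subsets of some set that contains $\varnothing$ and is closed under complementation and finite unions. A vector measure is a finitely additive map $\mu\colon\mathscr{F}\to X$. For a cardinal $\kappa$, a Banach space $X$ has the $\kappa$-$\mathsf{SVM}$ property if there is a constant $v<\infty$, depending only on $\kappa$ and $X$, such that for every set algebra $\mathscr{F}$ with $|\mathscr{F}|<\kappa$ and every $\nu\colon\mathscr{F}\to X$ satisfying $\|\nu(A\cup B)-\nu(A)-\nu(B)\|\leq 1$ for all disjoint $A,B\in\mathscr{F}$, there is a vector measure $\mu\colon\mathscr{F}\to X$ with $\|\nu(A)-\mu(A)\|\leq v$ for all $A\in\mathscr{F}$. A pair $(X,Y)$ of $F$-spaces (complete metrizable topological vector spaces) splits if, whenever $Z$ is an $F$-space (not necessarily locally convex) containing $Y$ as a closed subspace with $Z/Y\simeq X$ (linear homeomorphism), the exact sequence $0\to Y\to Z\to X\to 0$ splits, i.e. $Y$ is complemented in $Z$ by a continuous linear projection. *)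

theory Defs
  imports "HOL-Analysis.Analysis" "HOL-Probability.Discrete_Topology"
begin

unbundle cardinal_syntax

text \<open>
  Conventions. All spaces are real. A cardinal number is a relation \<open>\<kappa>\<close> with
  \<open>Card_order \<kappa>\<close>, as in the library; \<open>cardSuc \<kappa>\<close> is its successor.
\<close>

section \<open>The SVM property\<close>

text \<open>
  The underlying set of the algebra is taken inside the type \<open>'k\<close> that carries the cardinal \<open>\<kappa>\<close>.
  This is no restriction: an algebra with fewer than \<open>\<kappa>\<close> members is isomorphic to an algebra on a
  set of fewer than \<open>\<kappa>\<close> points. Lemma \<open>SVM_property_any_type\<close> below derives the bound, with the same
  constant, for algebras over an arbitrary type.
\<close>

definition SVM_property_with :: "real \<Rightarrow> 'k rel \<Rightarrow> 'p itself \<Rightarrow> 'x::real_normed_vector itself \<Rightarrow> bool" where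
  "SVM_property_with v \<kappa> _ _ \<longleftrightarrow>
     (\<forall>(\<Omega>::'p set) F (\<nu>::'p set \<Rightarrow> 'x).
        algebra \<Omega> F \<longrightarrow> |F| <o \<kappa> \<longrightarrow>
        (\<forall>A\<in>F. \<forall>B\<in>F. A \<inter> B = {} \<longrightarrow> norm (\<nu> (A \<union> B) - \<nu> A - \<nu> B) \<le> 1) \<longrightarrow>
        (\<exists>\<mu>::'p set \<Rightarrow> 'x. Measure_Space.additive F \<mu> \<and>
             (\<forall>A\<in>F. norm (\<nu> A - \<mu> A) \<le> v)))"

definition SVM_property :: "'k rel \<Rightarrow> 'x::real_normed_vector itself \<Rightarrow> bool" where
  "SVM_property \<kappa> X \<longleftrightarrow> (\<exists>v. SVM_property_with v \<kappa> TYPE('k) X)"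

lemma SVM_property_any_type:
  fixes \<kappa> :: "'k rel"
  assumes "SVM_property_with v \<kappa> TYPE('k) TYPE('x::real_normed_vector)"
  shows "SVM_property_with v \<kappa> TYPE('p) TYPE('x)"
  unfolding SVM_property_with_def
proof (intro allI impI)
  fix \<Omega> :: "'p set" and F and \<nu> :: "'p set \<Rightarrow> 'x"
  assume alg: "algebra \<Omega> F" and card: "|F| <o \<kappa>"
    and \<nu>: "\<forall>A\<in>F. \<forall>B\<in>F. A \<inter> B = {} \<longrightarrow> norm (\<nu> (A \<union> B) - \<nu> A - \<nu> B) \<le> 1"
  interpret algebra \<Omega> F by (rule alg)
  define p where "p A = (SOME x. x \<in> A)" for A :: "'p set"
  define P where "P = p ` (F - {{}})"
  have pin: "p A \<in> A \<inter> P" if "A \<in> F" "A \<noteq> {}" for A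
    using that someI_ex[of "\<lambda>x. x \<in> A"] by (auto simp: P_def p_def)
  have P\<Omega>: "P \<subseteq> \<Omega>"
    using pin sets_into_space by (fastforce simp: P_def)
  have "|P| \<le>o |F - {{}}|" unfolding P_def by (rule card_of_image)
  also have "|F - {{}}| \<le>o |F|" by (rule card_of_mono1) auto
  finally have "|P| <o \<kappa>" using card by (rule ordLeq_ordLess_trans)
  then have "|P| \<le>o |Field \<kappa>|"
    using card_of_mono2[OF ordLess_imp_ordLeq, of "|P|" \<kappa>] by (simp add: Field_card_of)
  then have "|P| \<le>o |UNIV :: 'k set|"
    using card_of_mono1[of "Field \<kappa>" UNIV] ordLeq_transitive by blast
  then obtain g :: "'p \<Rightarrow> 'k" where g: "inj_on g P"
    using card_of_ordLeq[of P "UNIV :: 'k set"] by auto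
  define h where "h A = g ` (A \<inter> P)" for A
  have h_Un: "h (A \<union> B) = h A \<union> h B" for A B by (auto simp: h_def)
  have h_Diff: "h (A - B) = h A - h B" for A B
    using g by (auto simp: h_def inj_on_def)
  have h_Int: "h (A \<inter> B) = h A \<inter> h B" for A B
    using g by (auto simp: h_def inj_on_def)
  have h_empty: "A = {}" if "A \<in> F" "h A = {}" for A
    using pin[OF that(1)] that(2) by (auto simp: h_def)
  have inj: "inj_on h F"
  proof (rule inj_onI)
    fix A B assume AB: "A \<in> F" "B \<in> F" "h A = h B"
    then have "h (A - B) = {}" "h (B - A) = {}" by (simp_all add: h_Diff)
    then show "A = B" using h_empty[of "A - B"] h_empty[of "B - A"] AB by auto
  qed
  define k where "k = the_inv_into F h"
  have k: "k (h A) = A" if "A \<in> F" for A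
    using the_inv_into_f_f[OF inj that] by (simp add: k_def)
  have "algebra (h \<Omega>) (h ` F)"
    unfolding algebra_iff_Un
  proof (intro conjI ballI)
    show "h ` F \<subseteq> Pow (h \<Omega>)" using sets_into_space by (fastforce simp: h_def)
    show "{} \<in> h ` F" by (force simp: h_def)
  next
    fix a assume "a \<in> h ` F"
    then show "h \<Omega> - a \<in> h ` F" by (auto simp: h_Diff[symmetric] intro!: imageI)
  next
    fix a b assume "a \<in> h ` F" "b \<in> h ` F"
    then show "a \<union> b \<in> h ` F" by (auto simp: h_Un[symmetric] intro!: imageI)
  qed
  moreover have "|h ` F| <o \<kappa>"
    using card_of_image[of h F] card by (rule ordLeq_ordLess_trans)
  moreover have "norm ((\<nu> \<circ> k) (h A \<union> h B) - (\<nu> \<circ> k) (h A) - (\<nu> \<circ> k) (h B)) \<le> 1"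
    if "A \<in> F" "B \<in> F" "h A \<inter> h B = {}" for A B
  proof -
    have "A \<inter> B = {}" using that h_empty[of "A \<inter> B"] by (auto simp: h_Int)
    moreover have "k (h A \<union> h B) = A \<union> B" using k[OF Un[OF that(1,2)]] by (simp add: h_Un)
    ultimately show ?thesis using \<nu> that by (simp add: k)
  qed
  then have "\<forall>A\<in>h ` F. \<forall>B\<in>h ` F. A \<inter> B = {} \<longrightarrow>
      norm ((\<nu> \<circ> k) (A \<union> B) - (\<nu> \<circ> k) A - (\<nu> \<circ> k) B) \<le> 1"
    by blast
  ultimately obtain \<mu> :: "'k set \<Rightarrow> 'x" where
    \<mu>: "Measure_Space.additive (h ` F) \<mu>"
       "\<forall>A\<in>h ` F. norm ((\<nu> \<circ> k) A - \<mu> A) \<le> v"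
    using assms unfolding SVM_property_with_def by blast
  have "(\<mu> \<circ> h) (A \<union> B) = (\<mu> \<circ> h) A + (\<mu> \<circ> h) B" if "A \<in> F" "B \<in> F" "A \<inter> B = {}" for A B
  proof -
    have "h A \<inter> h B = {}" using that(3) by (simp add: h_Int[symmetric]) (simp add: h_def)
    then show ?thesis using \<mu>(1) that by (simp add: h_Un Measure_Space.additive_def)
  qed
  then have "Measure_Space.additive F (\<mu> \<circ> h)"
    unfolding Measure_Space.additive_def by blast
  moreover have "norm (\<nu> A - (\<mu> \<circ> h) A) \<le> v" if "A \<in> F" for A
    using \<mu>(2) that k by auto
  ultimately show "\<exists>\<mu>. Measure_Space.additive F \<mu> \<and>
      (\<forall>A\<in>F. norm (\<nu> A - \<mu> A) \<le> v)"
    by (intro exI[of _ "\<mu> \<circ> h"]) simp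
qed

section \<open>F-spaces\<close>

text \<open>
  A real topological vector space whose topology comes from a complete metric; as is customary the
  metric is translation invariant, so that its Cauchy sequences are those of the vector space
  topology. Local convexity is not assumed.
\<close>

class f_space = real_vector + topological_ab_group_add +
  assumes tendsto_scaleR_Pair: "LIM x (nhds c \<times>\<^sub>F nhds a). fst x *\<^sub>R snd x :> nhds (c *\<^sub>R a)"
    and complete_invariant_metric:
      "\<exists>d. Metric_space UNIV d \<and> (\<forall>x y z. d (x + z) (y + z) = d x y) \<and>
           Metric_space.mcomplete UNIV d \<and> openin (Metric_space.mtopology UNIV d) = open"

instance banach \<subseteq> f_space
proof
  fix c :: real and a :: 'a
  show "LIM x (nhds c \<times>\<^sub>F nhds a). fst x *\<^sub>R snd x :> nhds (c *\<^sub>R a)"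
    by (intro tendsto_scaleR filterlim_fst filterlim_snd)
  show "\<exists>d::'a \<Rightarrow> 'a \<Rightarrow> real. Metric_space UNIV d \<and> (\<forall>x y z. d (x + z) (y + z) = d x y) \<and>
           Metric_space.mcomplete UNIV d \<and> openin (Metric_space.mtopology UNIV d) = open"
    by (rule exI[of _ dist])
       (simp add: Met_TC.Metric_space_axioms complete_UNIV)
qed

section \<open>Quotients and splitting pairs\<close>

definition quotient_proj :: "'z::ab_group_add set \<Rightarrow> 'z \<Rightarrow> 'z set" where
  "quotient_proj S z = (+) z ` S"

definition quotient_topology :: "'z::{ab_group_add,topological_space} set \<Rightarrow> 'z set topology" where
  "quotient_topology S =
     topology (\<lambda>U. U \<subseteq> range (quotient_proj S) \<and> open (quotient_proj S -` U))"

lemma openin_quotient_topology: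
  "openin (quotient_topology S) U \<longleftrightarrow> U \<subseteq> range (quotient_proj S) \<and> open (quotient_proj S -` U)"
proof -
  have "istopology (\<lambda>U. U \<subseteq> range (quotient_proj S) \<and> open (quotient_proj S -` U))"
    unfolding istopology_def by (auto simp: vimage_Union)
  then show ?thesis by (simp add: quotient_topology_def)
qed

lemma topspace_quotient_topology: "topspace (quotient_topology S) = range (quotient_proj S)"
proof -
  have "quotient_proj S -` range (quotient_proj S) = UNIV" by auto
  then have "openin (quotient_topology S) (range (quotient_proj S))"
    by (simp add: openin_quotient_topology)
  then show ?thesis
    using openin_subset openin_topspace openin_quotient_topology by (metis subset_antisym)
qed

lemma quotient_map_quotient_proj: "quotient_map euclidean (quotient_topology S) (quotient_proj S)"
  by (auto simp: quotient_map_def topspace_quotient_topology openin_quotient_topology vimage_def)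

text \<open>
  \<open>\<phi>\<close> is a linear homeomorphism of \<open>Z/S\<close> onto the linear subspace \<open>W\<close> (with the subspace topology).
  The vector space operations of \<open>Z/S\<close> are those that make the canonical surjection linear, so linearity
  of \<open>\<phi>\<close> is linearity of its composition with that surjection.
\<close>

definition quotient_linear_homeo ::
    "'z::{real_vector,topological_space} set \<Rightarrow> 'w::{real_vector,topological_space} set \<Rightarrow> ('z set \<Rightarrow> 'w) \<Rightarrow> bool"
  where "quotient_linear_homeo S W \<phi> \<longleftrightarrow>
     homeomorphic_map (quotient_topology S) (top_of_set W) \<phi> \<and> linear (\<phi> \<circ> quotient_proj S)"

text \<open>
  The pair \<open>(W, Y)\<close> splits, as far as F-spaces \<open>Z\<close> on the type \<open>'z\<close> are concerned. That \<open>Z\<close> contains \<open>Y\<close> as a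
  closed subspace is rendered by a linear topological embedding \<open>j\<close> of \<open>Y\<close> into \<open>Z\<close> with closed range.
  Here \<open>W\<close> is a linear subspace of the type \<open>'w\<close>, while \<open>Y\<close> and \<open>Z\<close> are whole types.
\<close>

definition pair_splits ::
    "'w::{real_vector,topological_space} set \<Rightarrow> 'y::f_space itself \<Rightarrow> 'z::f_space itself \<Rightarrow> bool"
  where "pair_splits W _ _ \<longleftrightarrow>
    (\<forall>j::'y \<Rightarrow> 'z.
       linear j \<longrightarrow> embedding_map euclidean euclidean j \<longrightarrow> closed (range j) \<longrightarrow>
       (\<exists>\<phi>. quotient_linear_homeo (range j) W \<phi>) \<longrightarrow>
       (\<exists>P::'z \<Rightarrow> 'z. linear P \<and> continuous_on UNIV P \<and> (\<forall>z. P (P z) = P z) \<and> range P = range j))"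

section \<open>The spaces of bounded functions and of null functions on a set\<close>

text \<open>
  Functions on \<open>I\<close> are identified with functions on the whole index type vanishing off \<open>I\<close>. The index type
  is given the discrete topology, so \<open>'i discrete \<Rightarrow>\<^sub>C real\<close> consists of all bounded functions, and
  its library norm is the supremum norm.
\<close>

definition linf :: "'i set \<Rightarrow> ('i discrete \<Rightarrow>\<^sub>C real) set" where
  "linf I = {f. \<forall>i. i \<notin> I \<longrightarrow> apply_bcontfun f (discrete i) = 0}"

definition c0 :: "'i set \<Rightarrow> ('i discrete \<Rightarrow>\<^sub>C real) set" where
  "c0 I = {f \<in> linf I. \<forall>\<epsilon>>0. finite {i\<in>I. \<bar>apply_bcontfun f (discrete i)\<bar> \<ge> \<epsilon>}}"

lemma bounded_functions_discrete:
  "range (\<lambda>f::'i discrete \<Rightarrow>\<^sub>C real. \<lambda>i. apply_bcontfun f (discrete i)) = {f. bounded (range f)}"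
proof (intro set_eqI iffI)
  fix g :: "'i \<Rightarrow> real"
  assume "g \<in> range (\<lambda>f. \<lambda>i. apply_bcontfun f (discrete i))"
  then obtain f where "g = (\<lambda>i. apply_bcontfun f (discrete i))" by auto
  then have "range g \<subseteq> range (apply_bcontfun f)" by auto
  then show "g \<in> {f. bounded (range f)}" using bounded_subset bounded_apply_bcontfun by blast
next
  fix g :: "'i \<Rightarrow> real"
  assume g: "g \<in> {f. bounded (range f)}"
  have "(\<lambda>x. g (of_discrete x)) \<in> bcontfun"
    using g by (auto simp: bcontfun_def continuous_on_open_invariant open_discrete
        intro: bounded_subset intro!: exI)
  then have "g = (\<lambda>i. apply_bcontfun (Bcontfun (\<lambda>x. g (of_discrete x))) (discrete i))"
    by (simp add: Bcontfun_inverse discrete_inverse)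
  then show "g \<in> range (\<lambda>f. \<lambda>i. apply_bcontfun f (discrete i))" by blast
qed

lemma subspace_linf: "subspace (linf I)"
  by (simp add: subspace_def linf_def)

lemma closed_linf: "closed (linf I)"
proof -
  have "linf I = (\<Inter>i\<in>- I. {f. apply_bcontfun f (discrete i) = 0})"
    by (auto simp: linf_def)
  moreover have "closed {f :: 'a discrete \<Rightarrow>\<^sub>C real. apply_bcontfun f (discrete i) = 0}" for i
  proof (rule closed_Collect_eq)
    show "continuous_on UNIV (\<lambda>f :: 'a discrete \<Rightarrow>\<^sub>C real. apply_bcontfun f (discrete i))"
      unfolding continuous_on_iff by (meson dist_bounded le_less_trans)
  qed simp
  ultimately show ?thesis by auto
qed

lemma subspace_c0: "subspace (c0 I)"
proof (rule subspaceI)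
  show "0 \<in> c0 I" by (simp add: c0_def linf_def)
next
  fix f g assume fg: "f \<in> c0 I" "g \<in> c0 I"
  have "finite {i\<in>I. \<bar>apply_bcontfun (f + g) (discrete i)\<bar> \<ge> \<epsilon>}" if "\<epsilon> > 0" for \<epsilon>
  proof (rule finite_subset)
    show "{i\<in>I. \<bar>apply_bcontfun (f + g) (discrete i)\<bar> \<ge> \<epsilon>} \<subseteq>
        {i\<in>I. \<bar>apply_bcontfun f (discrete i)\<bar> \<ge> \<epsilon>/2} \<union> {i\<in>I. \<bar>apply_bcontfun g (discrete i)\<bar> \<ge> \<epsilon>/2}"
      by auto
    show "finite \<dots>" using fg half_gt_zero[OF \<open>\<epsilon> > 0\<close>] unfolding c0_def by blast
  qed
  then show "f + g \<in> c0 I" using fg by (auto simp: c0_def linf_def)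
next
  fix c f assume f: "f \<in> c0 I"
  have "finite {i\<in>I. \<bar>apply_bcontfun (c *\<^sub>R f) (discrete i)\<bar> \<ge> \<epsilon>}" if "\<epsilon> > 0" for \<epsilon>
  proof (cases "c = 0")
    case False
    then have "{i\<in>I. \<bar>apply_bcontfun (c *\<^sub>R f) (discrete i)\<bar> \<ge> \<epsilon>} =
        {i\<in>I. \<bar>apply_bcontfun f (discrete i)\<bar> \<ge> \<epsilon> / \<bar>c\<bar>}"
      by (auto simp: abs_mult field_simps)
    moreover have "\<epsilon> / \<bar>c\<bar> > 0" using that False by simp
    ultimately show ?thesis using f by (simp add: c0_def)
  qed (use that in simp)
  then show "c *\<^sub>R f \<in> c0 I" using f by (auto simp: c0_def linf_def)
qed

lemma closed_c0: "closed (c0 I)"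
  unfolding closed_sequential_limits
proof (intro allI impI, elim conjE)
  fix F f assume F: "\<forall>n. F n \<in> c0 I" and lim: "F \<longlonglongrightarrow> f"
  have "f \<in> linf I"
    using closed_linf F lim unfolding closed_sequential_limits c0_def by blast
  moreover have "finite {i\<in>I. \<bar>apply_bcontfun f (discrete i)\<bar> \<ge> \<epsilon>}" if "\<epsilon> > 0" for \<epsilon>
  proof -
    obtain n where n: "dist (F n) f < \<epsilon>/2"
      using lim half_gt_zero[OF \<open>\<epsilon> > 0\<close>] unfolding lim_sequentially by blast
    have "{i\<in>I. \<bar>apply_bcontfun f (discrete i)\<bar> \<ge> \<epsilon>} \<subseteq> {i\<in>I. \<bar>apply_bcontfun (F n) (discrete i)\<bar> \<ge> \<epsilon>/2}"
    proof safe
      fix i assume "\<epsilon> \<le> \<bar>apply_bcontfun f (discrete i)\<bar>"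
      moreover have "dist (F n (discrete i)) (f (discrete i)) < \<epsilon>/2"
        using dist_bounded[of "F n" "discrete i" f] n by linarith
      ultimately show "\<epsilon>/2 \<le> \<bar>apply_bcontfun (F n) (discrete i)\<bar>"
        unfolding dist_real_def by arith
    qed
    moreover have "finite {i\<in>I. \<bar>apply_bcontfun (F n) (discrete i)\<bar> \<ge> \<epsilon>/2}"
      using F half_gt_zero[OF \<open>\<epsilon> > 0\<close>] unfolding c0_def by blast
    ultimately show ?thesis by (rule finite_subset)
  qed
  ultimately show "f \<in> c0 I" by (simp add: c0_def)
qed

end

theory Submission
  imports Defs
begin

text \<open>
  The space \<open>Z\<close> is locally bounded, hence quasi-normed, and the indicators \<open>1\<^sub>A\<close> have lifts \<open>z A\<close>
  of bounded quasi-norm. For a (discontinuous) linear right inverse \<open>L\<close> of the quotient map, the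
  set function \<open>\<nu> A = z A - L 1\<^sub>A\<close> takes its values in \<open>X\<close> and is additive up to a bounded error.
  If \<open>\<mu>\<close> is a vector measure near \<open>\<nu>\<close>, then \<open>\<rho> A = L 1\<^sub>A + \<mu> A\<close> is a bounded \<open>Z\<close>-valued measure that
  lifts the indicators, and integration against \<open>\<rho>\<close> is a continuous linear lifting of the
  uniform limits of simple functions. Integrating over all subsets of \<open>\<Gamma>\<close> gives \<open>\<ell>\<^sub>\<infinity>(\<Gamma>)\<close>, over the
  finite ones \<open>c\<^sub>0(\<Gamma>)\<close>.
\<close>

section \<open>Complete quasi-norms\<close>

text \<open>The obstacle is that \<open>Z\<close> need not be locally convex. The triangle
  inequality of its quasi-norm carries a factor \<open>K\<close>, which over n summands grows to a
  power of \<open>K\<close>, so a bound for \<open>\<rho>\<close> on sets does not at once bound the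
  integrals of simple functions with many values. A rounding argument makes the bound independent of
  the number of values. The discontinuity of \<open>L\<close> does no harm: its values cancel both
  in the defect of \<open>\<nu>\<close> and in the difference of \<open>\<rho> A\<close> and
  \<open>z A\<close>.

  Both function spaces consist of the bounded functions whose levels, the sets where the modulus is
  at least some d > 0, belong to an ideal of sets. For infinite \<Gamma> the ideal of finite sets is
  not an algebra, so for (ii) the property is applied to the finite and cofinite sets together.
  These are only as many as the elements of \<Gamma>, which explains the smaller cardinal
  there.\<close>

locale quasi_banach =
  fixes Q :: "'z::real_vector \<Rightarrow> real" and K :: real
  assumes scale: "Q (a *\<^sub>R x) = \<bar>a\<bar> * Q x"
    and triangle: "Q (x + y) \<le> K * (Q x + Q y)"
    and K_ge_1: "1 \<le> K"
    and zeroD: "Q x = 0 \<Longrightarrow> x = 0"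
    and complete: "(\<And>e. 0 < e \<Longrightarrow> \<exists>N::nat. \<forall>m\<ge>N. \<forall>n\<ge>N. Q (s m - s n) < e) \<Longrightarrow>
      \<exists>l. (\<lambda>n. Q (s n - l)) \<longlonglongrightarrow> 0"
begin

lemma zero [simp]: "Q 0 = 0"
  using scale[of 0 0] by simp

lemma minus: "Q (- x) = Q x"
  using scale[of "-1" x] by simp

lemma nonneg: "0 \<le> Q x"
proof -
  have "0 \<le> K * (Q x + Q (- x))" using triangle[of x "- x"] by simp
  with K_ge_1 show ?thesis by (simp add: minus zero_le_mult_iff)
qed

lemma triangle_le:
  assumes "Q x \<le> a" "Q y \<le> b"
  shows "Q (x + y) \<le> K * (a + b)"
proof (rule order_trans[OF triangle])
  show "K * (Q x + Q y) \<le> K * (a + b)"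
    using assms K_ge_1 by (intro mult_left_mono add_mono) auto
qed

lemma triangle_diff_le: "Q x \<le> a \<Longrightarrow> Q y \<le> b \<Longrightarrow> Q (x - y) \<le> K * (a + b)"
  using triangle_le[of x a "- y" b] by (simp add: minus)

text \<open>A quasi-norm can be discontinuous. Identities between limits are therefore reduced to
  this criterion: both sides are compared through approximations with an error proportional to
  \<open>d\<close>.\<close>

lemma eq_zero_if_small:
  assumes "\<And>d. 0 < d \<Longrightarrow> Q x \<le> c * d"
  shows "x = 0"
proof (rule zeroD)
  have "Q x \<le> e" if "0 < e" for e
  proof -
    \<comment> \<open>The denominator \<open>\<bar>c\<bar> + 1\<close> covers every sign of
      \<open>c\<close>, zero included.\<close>
    have "0 < e / (\<bar>c\<bar> + 1)" using that by (simp add: add_nonneg_pos)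
    then have "Q x \<le> c * (e / (\<bar>c\<bar> + 1))" by (rule assms)
    also have "\<dots> \<le> (\<bar>c\<bar> + 1) * (e / (\<bar>c\<bar> + 1))"
      using that by (intro mult_right_mono) auto
    also have "\<dots> = e" by (simp add: add_nonneg_pos)
    finally show ?thesis .
  qed
  then have "Q x \<le> 0" by (rule field_le_epsilon[where y = 0, simplified])
  with nonneg[of x] show "Q x = 0" by simp
qed

text \<open>Each further summand costs one factor \<open>K\<close>. This loss confines the bound to
  sums whose number of terms is fixed in advance.\<close>

lemma sum_le:
  assumes "finite S"
  shows "Q (\<Sum>i\<in>S. z i) \<le> K ^ card S * (\<Sum>i\<in>S. Q (z i))"
  using assms
proof induction
  case (insert i S)
  have "Q (\<Sum>i\<in>insert i S. z i) \<le> K * (Q (z i) + Q (\<Sum>i\<in>S. z i))"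
    using insert.hyps triangle by simp
  also have "\<dots> \<le> K * (K ^ card S * Q (z i) + K ^ card S * (\<Sum>i\<in>S. Q (z i)))"
    using insert.IH K_ge_1 mult_right_mono[OF one_le_power[OF K_ge_1, of "card S"] nonneg[of "z i"]]
    by (intro mult_left_mono add_mono) auto
  also have "\<dots> = K ^ card (insert i S) * (\<Sum>i\<in>insert i S. Q (z i))"
    using insert.hyps by (simp add: algebra_simps)
  finally show ?case .
qed simp

end

section \<open>Integration of simple functions against an additive set function\<close>

text \<open>An ideal in place of an algebra admits the finite subsets of an infinite set. Closure
  under subsets puts the nonzero level sets of a function into the ideal as soon as its support is
  there.\<close>

locale set_ideal =
  fixes R :: "'a set set"
  assumes empty: "{} \<in> R"
    and subset: "A \<in> R \<Longrightarrow> B \<subseteq> A \<Longrightarrow> B \<in> R"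
    and Un: "A \<in> R \<Longrightarrow> B \<in> R \<Longrightarrow> A \<union> B \<in> R"

text \<open>The values lie in any type with a zero, so that a pair of real simple functions is again
  simple and serves as their common refinement.\<close>

definition simple_fun :: "'a set set \<Rightarrow> ('a \<Rightarrow> 'b::zero) \<Rightarrow> bool" where
  "simple_fun R h \<longleftrightarrow> finite (range h) \<and> {x. h x \<noteq> 0} \<in> R"

text \<open>The value 0 is left out because the zero set of \<open>f\<close> need not belong to the
  ideal on which \<open>\<mu>\<close> is additive.\<close>

definition simple_int :: "('a set \<Rightarrow> 'z::real_vector) \<Rightarrow> ('a \<Rightarrow> real) \<Rightarrow> 'z" where
  "simple_int \<mu> f = (\<Sum>c\<in>range f - {0}. c *\<^sub>R \<mu> (f -` {c}))"

context set_ideal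
begin

lemma simple_fun_comp:
  assumes "simple_fun R h" "\<phi> 0 = 0"
  shows "simple_fun R (\<lambda>x. \<phi> (h x))"
proof -
  have "{x. \<phi> (h x) \<noteq> 0} \<subseteq> {x. h x \<noteq> 0}" using assms(2) by auto
  moreover have "range (\<lambda>x. \<phi> (h x)) = \<phi> ` range h" by auto
  ultimately show ?thesis using assms(1) subset unfolding simple_fun_def by auto
qed

lemma simple_fun_Pair:
  assumes "simple_fun R f" "simple_fun R g"
  shows "simple_fun R (\<lambda>x. (f x, g x))"
proof -
  have "range (\<lambda>x. (f x, g x)) \<subseteq> range f \<times> range g" by auto
  then have "finite (range (\<lambda>x. (f x, g x)))"
    by (rule finite_subset) (use assms in \<open>auto simp: simple_fun_def\<close>)
  moreover have "{x. (f x, g x) \<noteq> 0} = {x. f x \<noteq> 0} \<union> {x. g x \<noteq> 0}"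
    by (auto simp: zero_prod_def)
  ultimately show ?thesis using assms Un by (simp add: simple_fun_def)
qed

lemma simple_fun_add:
  fixes f g :: "'a \<Rightarrow> real"
  assumes "simple_fun R f" "simple_fun R g"
  shows "simple_fun R (\<lambda>x. f x + g x)"
  using simple_fun_comp[OF simple_fun_Pair[OF assms], of "\<lambda>(a, b). a + b"]
  by (simp add: zero_prod_def)

lemma simple_fun_diff:
  fixes f g :: "'a \<Rightarrow> real"
  assumes "simple_fun R f" "simple_fun R g"
  shows "simple_fun R (\<lambda>x. f x - g x)"
  using simple_fun_add[OF assms(1) simple_fun_comp[OF assms(2), of uminus]] by simp

lemma simple_fun_vimage:
  assumes "simple_fun R h" "c \<noteq> 0"
  shows "h -` {c} \<in> R"
  using assms by (auto simp: simple_fun_def intro: subset)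

lemma finite_Union:
  assumes "finite I" "\<And>i. i \<in> I \<Longrightarrow> A i \<in> R"
  shows "(\<Union>i\<in>I. A i) \<in> R"
  using assms by (induction I) (auto intro: empty Un)

lemma additive_sum:
  fixes \<mu> :: "'a set \<Rightarrow> 'z::ab_group_add"
  assumes \<mu>: "Measure_Space.additive R \<mu>" and "finite I"
    and "\<And>i. i \<in> I \<Longrightarrow> A i \<in> R" "disjoint_family_on A I"
  shows "\<mu> (\<Union>i\<in>I. A i) = (\<Sum>i\<in>I. \<mu> (A i))"
  using assms(2-)
proof (induction I)
  case empty
  have "\<mu> {} = \<mu> {} + \<mu> {}"
    using \<mu> set_ideal.empty[OF set_ideal_axioms]
    unfolding Measure_Space.additive_def by (metis Un_empty_right inf.idem)
  then show ?case by simp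
next
  case (insert i I)
  have "A i \<inter> (\<Union>i\<in>I. A i) = {}"
    using insert by (auto simp: disjoint_family_on_def)
  moreover have "(\<Union>i\<in>I. A i) \<in> R" using insert by (intro finite_Union) auto
  ultimately have "\<mu> (A i \<union> (\<Union>i\<in>I. A i)) = \<mu> (A i) + \<mu> (\<Union>i\<in>I. A i)"
    using \<mu> insert.prems(1) unfolding Measure_Space.additive_def by blast
  also have "\<mu> (\<Union>i\<in>I. A i) = (\<Sum>i\<in>I. \<mu> (A i))"
    using insert.prems by (intro insert.IH) (auto simp: disjoint_family_on_def)
  finally show ?case using insert.hyps by simp
qed

text \<open>A nonzero level set of the composition is a disjoint union of level sets of
  \<open>h\<close>, so the integral may be computed over the finer partition. With \<open>h\<close>
  a pair of functions and \<open>\<phi>\<close> the sum or a coordinate, three integrals refer to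
  one partition, which yields additivity.\<close>

lemma simple_int_comp:
  fixes h :: "'a \<Rightarrow> 'b::zero" and \<phi> :: "'b \<Rightarrow> real"
  assumes \<mu>: "Measure_Space.additive R \<mu>" and h: "simple_fun R h" and \<phi>: "\<phi> 0 = 0"
  shows "simple_int \<mu> (\<lambda>x. \<phi> (h x)) = (\<Sum>c\<in>range h - {0}. \<phi> c *\<^sub>R \<mu> (h -` {c}))"
proof -
  let ?f = "\<lambda>x. \<phi> (h x)"
  let ?S = "{c \<in> range h. \<phi> c \<noteq> 0}"
  have fin: "finite (range h)" using h by (simp add: simple_fun_def)
  have S: "?S \<subseteq> range h - {0}" using \<phi> by auto
  have "r *\<^sub>R \<mu> (?f -` {r}) = (\<Sum>c\<in>{c\<in>?S. \<phi> c = r}. \<phi> c *\<^sub>R \<mu> (h -` {c}))"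
    if "r \<in> range ?f - {0}" for r
  proof -
    have "?f -` {r} = (\<Union>c\<in>{c\<in>?S. \<phi> c = r}. h -` {c})" using that by auto
    also have "\<mu> \<dots> = (\<Sum>c\<in>{c\<in>?S. \<phi> c = r}. \<mu> (h -` {c}))"
      using \<phi> fin by (intro additive_sum \<mu> simple_fun_vimage h) (auto simp: disjoint_family_on_def)
    finally show ?thesis by (simp add: scaleR_sum_right)
  qed
  then have "simple_int \<mu> ?f =
      (\<Sum>r\<in>range ?f - {0}. \<Sum>c\<in>{c\<in>?S. \<phi> c = r}. \<phi> c *\<^sub>R \<mu> (h -` {c}))"
    unfolding simple_int_def by (rule sum.cong[OF refl])
  also have "\<dots> = (\<Sum>c\<in>?S. \<phi> c *\<^sub>R \<mu> (h -` {c}))"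
  proof (rule sum.group)
    have "range ?f = \<phi> ` range h" by auto
    then show "finite (range ?f - {0})" using fin by simp
  qed (use fin in auto)
  also have "\<dots> = (\<Sum>c\<in>range h - {0}. \<phi> c *\<^sub>R \<mu> (h -` {c}))"
    using fin S by (intro sum.mono_neutral_left) auto
  finally show ?thesis .
qed

lemma simple_int_add:
  assumes \<mu>: "Measure_Space.additive R \<mu>" and fg: "simple_fun R f" "simple_fun R g"
  shows "simple_int \<mu> (\<lambda>x. f x + g x) = simple_int \<mu> f + simple_int \<mu> g"
proof -
  note h = simple_fun_Pair[OF fg]
  show ?thesis
    using simple_int_comp[OF \<mu> h, of "\<lambda>c. fst c + snd c"] simple_int_comp[OF \<mu> h, of fst]
      simple_int_comp[OF \<mu> h, of snd]
    by (simp add: scaleR_add_left sum.distrib)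
qed

lemma simple_int_scale:
  assumes "Measure_Space.additive R \<mu>" "simple_fun R f"
  shows "simple_int \<mu> (\<lambda>x. a * f x) = a *\<^sub>R simple_int \<mu> f"
  using simple_int_comp[OF assms, of "\<lambda>c. a * c"]
  by (simp add: simple_int_def scaleR_sum_right)

end

section \<open>Boundedness of the integral in a quasi-normed space\<close>

locale bounded_additive = quasi_banach Q K + set_ideal R
  for Q :: "'z::real_vector \<Rightarrow> real" and K and R :: "'a set set" +
  fixes \<mu> :: "'a set \<Rightarrow> 'z" and v :: real
  assumes additive: "Measure_Space.additive R \<mu>"
    and bounded: "A \<in> R \<Longrightarrow> Q (\<mu> A) \<le> v"
begin

lemma v_nonneg: "0 \<le> v"
  using bounded[OF empty] nonneg[of "\<mu> {}"] by linarith

text \<open>Each of the at most \<open>m\<close> summands has quasi-norm at most \<open>v\<close>,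
  so \<open>sum_le\<close> applies. The dependence on \<open>m\<close> is what the rounding argument
  removes.\<close>

lemma simple_int_le_card:
  assumes f: "simple_fun R f" and le: "\<And>x. \<bar>f x\<bar> \<le> 1" and card: "card (range f - {0}) \<le> m"
  shows "Q (simple_int \<mu> f) \<le> K ^ m * (m * v)"
proof -
  let ?S = "range f - {0}"
  have fin: "finite ?S" using f by (simp add: simple_fun_def)
  have "Q (simple_int \<mu> f) \<le> K ^ card ?S * (\<Sum>c\<in>?S. Q (c *\<^sub>R \<mu> (f -` {c})))"
    unfolding simple_int_def by (rule sum_le[OF fin])
  also have "\<dots> \<le> K ^ card ?S * (\<Sum>c\<in>?S. v)"
  proof (intro mult_left_mono sum_mono)
    fix c assume c: "c \<in> ?S"
    then have "f -` {c} \<in> R" using f by (auto intro: simple_fun_vimage)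
    then have "\<bar>c\<bar> * Q (\<mu> (f -` {c})) \<le> 1 * v"
      using c le v_nonneg nonneg by (intro mult_mono bounded) auto
    then show "Q (c *\<^sub>R \<mu> (f -` {c})) \<le> v" by (simp add: scale)
  qed (use K_ge_1 in simp)
  also have "\<dots> = K ^ card ?S * (card ?S * v)" by simp
  also have "\<dots> \<le> K ^ m * (m * v)"
    using card K_ge_1 v_nonneg by (intro mult_mono power_increasing) auto
  finally show ?thesis .
qed

text \<open>
  Rounding to multiples of \<open>1/N\<close> writes \<open>f\<close> as a function with at most \<open>2N + 1\<close> values plus \<open>1/N\<close>
  times a function in the unit ball having no more values than \<open>f\<close>. As \<open>N \<ge> 2K\<close>, the supremum \<open>E\<close> of
  \<open>Q (simple_int \<mu> f)\<close> over the functions in the unit ball with at most \<open>m\<close> values, finite by the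
  previous lemma, satisfies \<open>E \<le> K D + E / 2\<close> with \<open>D\<close> independent of \<open>m\<close>.
\<close>

lemma simple_int_bounded_unit:
  obtains C where "0 \<le> C"
    "\<And>f. simple_fun R f \<Longrightarrow> (\<And>x. \<bar>f x\<bar> \<le> 1) \<Longrightarrow> Q (simple_int \<mu> f) \<le> C"
proof -
  obtain N :: nat where N: "2 * K \<le> N" using real_arch_simple by blast
  with K_ge_1 have N0: "0 < real N" by linarith
  define M where "M = 2 * N + 1"
  define D where "D = K ^ M * (M * v)"
  have D0: "0 \<le> D" using K_ge_1 v_nonneg by (simp add: D_def)
  have "Q (simple_int \<mu> f) \<le> 2 * K * D" if f: "simple_fun R f" and f1: "\<And>x. \<bar>f x\<bar> \<le> 1" for f
  proof -
    define m where "m = card (range f - {0})"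
    define \<S> where "\<S> = {f :: 'a \<Rightarrow> real. simple_fun R f \<and> (\<forall>x. \<bar>f x\<bar> \<le> 1) \<and> card (range f - {0}) \<le> m}"
    define E where "E = Sup ((\<lambda>f. Q (simple_int \<mu> f)) ` \<S>)"
    have fS: "f \<in> \<S>" using f f1 by (simp add: \<S>_def m_def)
    have bdd: "bdd_above ((\<lambda>f. Q (simple_int \<mu> f)) ` \<S>)"
      by (rule bdd_aboveI2[where M = "K ^ m * (m * v)"]) (auto simp: \<S>_def intro: simple_int_le_card)
    have leE: "Q (simple_int \<mu> g) \<le> E" if "g \<in> \<S>" for g
      unfolding E_def by (rule cSUP_upper[OF that bdd])
    have "Q (simple_int \<mu> g) \<le> K * D + E / 2" if gS: "g \<in> \<S>" for g
    proof -
      have g: "simple_fun R g" and g1: "\<And>x. \<bar>g x\<bar> \<le> 1" and card_g: "card (range g - {0}) \<le> m"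
        using gS by (auto simp: \<S>_def)
      define p where "p x = real_of_int \<lfloor>N * g x\<rfloor> / N" for x
      define r where "r x = frac (N * g x)" for x
      have p: "simple_fun R p" unfolding p_def
        by (rule simple_fun_comp[OF g, of "\<lambda>c. real_of_int \<lfloor>N * c\<rfloor> / N"]) simp
      have r: "simple_fun R r" unfolding r_def
        by (rule simple_fun_comp[OF g, of "\<lambda>c. frac (N * c)"]) simp
      have g_eq: "g = (\<lambda>x. p x + 1 / N * r x)"
        using N0 by (auto simp: p_def r_def frac_def field_simps)
      have floor: "- int N \<le> \<lfloor>N * g x\<rfloor>" "\<lfloor>N * g x\<rfloor> \<le> int N" for x
      proof -
        have "\<bar>N * g x\<bar> \<le> N * 1" using g1[of x] N0 by (simp add: abs_mult)
        then have "- real N \<le> N * g x" "N * g x \<le> N" by auto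
        then show "- int N \<le> \<lfloor>N * g x\<rfloor>" "\<lfloor>N * g x\<rfloor> \<le> int N"
          by (simp_all add: le_floor_iff floor_le_iff)
      qed
      have p1: "\<bar>p x\<bar> \<le> 1" for x
      proof -
        have "\<bar>real_of_int \<lfloor>N * g x\<rfloor>\<bar> \<le> N" using floor[of x] by linarith
        then show ?thesis using N0 by (simp add: p_def)
      qed
      have "range p \<subseteq> (\<lambda>k. real_of_int k / N) ` {- int N..int N}"
        using floor by (auto simp: p_def)
      then have "card (range p - {0}) \<le> card ((\<lambda>k. real_of_int k / N) ` {- int N..int N})"
        by (intro card_mono) auto
      also have "\<dots> \<le> card {- int N..int N}" by (rule card_image_le) simp
      also have "\<dots> = M" by (simp add: M_def)
      finally have "Q (simple_int \<mu> p) \<le> D"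
        unfolding D_def by (rule simple_int_le_card[OF p p1])
      moreover have "Q (simple_int \<mu> r) \<le> E"
      proof (rule leE)
        \<comment> \<open>\<open>frac\<close> maps 0 to 0, so a nonzero value of \<open>r\<close>
          comes from a nonzero value of \<open>g\<close>.\<close>
        have "range r - {0} \<subseteq> (\<lambda>c. frac (N * c)) ` (range g - {0})" by (auto simp: r_def)
        then have "card (range r - {0}) \<le> card ((\<lambda>c. frac (N * c)) ` (range g - {0}))"
          using g by (intro card_mono) (auto simp: simple_fun_def)
        also have "\<dots> \<le> card (range g - {0})"
          using g by (intro card_image_le) (auto simp: simple_fun_def)
        finally have "card (range r - {0}) \<le> m" using card_g by simp
        then show "r \<in> \<S>" using r by (simp add: \<S>_def r_def less_imp_le[OF frac_lt_1])
      qed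
      moreover have "simple_int \<mu> g = simple_int \<mu> p + (1 / N) *\<^sub>R simple_int \<mu> r"
      proof -
        have "simple_fun R (\<lambda>x. 1 / N * r x)" by (rule simple_fun_comp[OF r]) simp
        then show ?thesis
          by (subst g_eq) (simp only: simple_int_add[OF additive p] simple_int_scale[OF additive r])
      qed
      then have "Q (simple_int \<mu> g) \<le> K * (Q (simple_int \<mu> p) + 1 / N * Q (simple_int \<mu> r))"
        using triangle[of "simple_int \<mu> p" "(1 / N) *\<^sub>R simple_int \<mu> r"] by (simp add: scale)
      moreover have "K * (1 / N * Q (simple_int \<mu> r)) \<le> Q (simple_int \<mu> r) / 2"
        using mult_right_mono[OF N nonneg[of "simple_int \<mu> r"]] N0 by (simp add: field_simps)
      moreover have "K * Q (simple_int \<mu> p) \<le> K * D"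
        using calculation(1) K_ge_1 by (intro mult_left_mono) auto
      ultimately show ?thesis unfolding distrib_left by linarith
    qed
    then have "E \<le> K * D + E / 2"
      unfolding E_def using fS by (intro cSUP_least) (auto simp: E_def)
    with leE[OF fS] show ?thesis by simp
  qed
  moreover have "0 \<le> 2 * K * D" using D0 K_ge_1 by simp
  ultimately show ?thesis using that by blast
qed

lemma simple_int_bounded:
  obtains C where "0 \<le> C"
    "\<And>f e. simple_fun R f \<Longrightarrow> (\<And>x. \<bar>f x\<bar> \<le> e) \<Longrightarrow> Q (simple_int \<mu> f) \<le> C * e"
proof -
  obtain C where C: "0 \<le> C"
    "\<And>f. simple_fun R f \<Longrightarrow> (\<And>x. \<bar>f x\<bar> \<le> 1) \<Longrightarrow> Q (simple_int \<mu> f) \<le> C"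
    by (rule simple_int_bounded_unit) blast
  have "Q (simple_int \<mu> f) \<le> C * e" if f: "simple_fun R f" and e: "\<And>x. \<bar>f x\<bar> \<le> e" for f e
  proof (cases "e > 0")
    case True
    have "simple_fun R (\<lambda>x. 1 / e * f x)" by (rule simple_fun_comp[OF f]) simp
    moreover have "\<bar>1 / e * f x\<bar> \<le> 1" for x using e[of x] True by (simp add: abs_mult)
    ultimately have "Q (simple_int \<mu> (\<lambda>x. 1 / e * f x)) \<le> C" by (rule C(2))
    then have "1 / e * Q (simple_int \<mu> f) \<le> C"
      using True by (simp only: simple_int_scale[OF additive f] scale) simp
    then show ?thesis using True by (simp add: field_simps)
  next
    case False
    have "f x = 0" for x using e[of x] False by linarith
    then have "f = (\<lambda>x. 0)" by auto
    \<comment> \<open>Any point will do: \<open>e\<close> bounds an absolute value there.\<close>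
    moreover have "0 \<le> e" using e[of undefined] by linarith
    ultimately show ?thesis using C(1) by (simp add: simple_int_def)
  qed
  with C(1) show ?thesis using that by blast
qed

end

section \<open>Extension to uniform limits of simple functions\<close>

definition simple_limit :: "'a set set \<Rightarrow> ('a \<Rightarrow> real) \<Rightarrow> bool" where
  "simple_limit R f \<longleftrightarrow> (\<forall>d>0. \<exists>s. simple_fun R s \<and> (\<forall>x. \<bar>s x - f x\<bar> \<le> d))"

text \<open>The approximant is 0 where \<open>\<bar>f x\<bar> < d\<close> and rounds
  \<open>f x\<close> down to a multiple of \<open>d\<close> elsewhere. The cut-off keeps its support
  inside one level set, which lies in \<open>R\<close> even if the support of \<open>f\<close> does
  not.\<close>

lemma (in set_ideal) simple_limitI:
  assumes "bounded (range f)" and levels: "\<And>d. 0 < d \<Longrightarrow> {x. d \<le> \<bar>f x\<bar>} \<in> R"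
  shows "simple_limit R f"
  unfolding simple_limit_def
proof (intro allI impI)
  fix d :: real assume d: "0 < d"
  obtain b where b: "\<And>x. \<bar>f x\<bar> \<le> b"
    using assms(1) by (auto simp: bounded_iff)
  define s where "s x = (if d \<le> \<bar>f x\<bar> then d * \<lfloor>f x / d\<rfloor> else 0)" for x
  have "range s \<subseteq> insert 0 ((\<lambda>k. d * real_of_int k) ` {\<lfloor>- b / d\<rfloor>..\<lfloor>b / d\<rfloor>})"
  proof
    fix y assume "y \<in> range s"
    then obtain x where y: "y = s x" by auto
    have "- b \<le> f x" "f x \<le> b" using b[of x] by auto
    then have "- b / d \<le> f x / d" "f x / d \<le> b / d" using d by (auto intro!: divide_right_mono simp del: divide_minus_left)
    then have "\<lfloor>f x / d\<rfloor> \<in> {\<lfloor>- b / d\<rfloor>..\<lfloor>b / d\<rfloor>}" by (auto intro: floor_mono)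
    then show "y \<in> insert 0 ((\<lambda>k. d * real_of_int k) ` {\<lfloor>- b / d\<rfloor>..\<lfloor>b / d\<rfloor>})"
      by (auto simp: y s_def)
  qed
  then have "finite (range s)" by (rule finite_subset) simp
  moreover have "{x. s x \<noteq> 0} \<in> R" by (rule subset[OF levels[OF d]]) (auto simp: s_def)
  moreover have "\<bar>s x - f x\<bar> \<le> d" for x
  proof (cases "d \<le> \<bar>f x\<bar>")
    case True
    have "d * \<lfloor>f x / d\<rfloor> \<le> d * (f x / d)" "d * (f x / d) \<le> d * (\<lfloor>f x / d\<rfloor> + 1)"
      using d by (intro mult_left_mono; linarith)+
    then show ?thesis using d True by (simp add: s_def algebra_simps abs_le_iff)
  qed (simp add: s_def)
  ultimately show "\<exists>s. simple_fun R s \<and> (\<forall>x. \<bar>s x - f x\<bar> \<le> d)"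
    by (auto simp: simple_fun_def)
qed

context bounded_additive
begin

lemma simple_int_diff:
  assumes "simple_fun R f" "simple_fun R g"
  shows "simple_int \<mu> (\<lambda>x. f x - g x) = simple_int \<mu> f - simple_int \<mu> g"
  using simple_int_add[OF additive assms(1) simple_fun_comp[OF assms(2), of uminus]]
    simple_int_scale[OF additive assms(2), of "-1"] by simp

text \<open>\<open>S f\<close> is a limit of integrals of simple functions, but it is recorded
  through an error estimate against every simple approximant. All further properties of
  \<open>S\<close> follow from this estimate without a return to sequences.\<close>

lemma extension_exists:
  obtains S C where "0 \<le> C"
    "\<And>f s d. simple_limit R f \<Longrightarrow> simple_fun R s \<Longrightarrow> (\<And>x. \<bar>s x - f x\<bar> \<le> d) \<Longrightarrow>
      Q (simple_int \<mu> s - S f) \<le> C * d"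
proof -
  obtain C where C: "0 \<le> C"
    "\<And>f e. simple_fun R f \<Longrightarrow> (\<And>x. \<bar>f x\<bar> \<le> e) \<Longrightarrow> Q (simple_int \<mu> f) \<le> C * e"
    by (rule simple_int_bounded) blast
  have C_diff: "Q (simple_int \<mu> s - simple_int \<mu> t) \<le> C * (d + e)"
    if "simple_fun R s" "simple_fun R t" "\<And>x. \<bar>s x - f x\<bar> \<le> d" "\<And>x. \<bar>t x - f x\<bar> \<le> e"
    for s t f d e
  proof -
    have "\<bar>s x - t x\<bar> \<le> d + e" for x using that(3,4)[of x] by linarith
    then show ?thesis
      using C(2)[OF simple_fun_diff[OF that(1,2)]] by (simp add: simple_int_diff that)
  qed
  have "\<exists>z. \<forall>s d. simple_fun R s \<longrightarrow> (\<forall>x. \<bar>s x - f x\<bar> \<le> d) \<longrightarrow> Q (simple_int \<mu> s - z) \<le> K * C * d"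
    if f: "simple_limit R f" for f
  proof -
    have "\<exists>s. simple_fun R s \<and> (\<forall>x. \<bar>s x - f x\<bar> \<le> inverse (real (Suc n)))" for n
      using f unfolding simple_limit_def by simp
    then obtain s where s: "\<And>n. simple_fun R (s n)"
      and sf: "\<And>n x. \<bar>s n x - f x\<bar> \<le> inverse (real (Suc n))" by metis
    have "\<exists>l. (\<lambda>n. Q (simple_int \<mu> (s n) - l)) \<longlonglongrightarrow> 0"
    proof (rule complete)
      fix e :: real assume e: "0 < e"
      have "(\<lambda>n. C * (2 * inverse (real (Suc n)))) \<longlonglongrightarrow> C * (2 * 0)"
        by (intro tendsto_mult tendsto_const LIMSEQ_inverse_real_of_nat)
      then have "\<forall>\<^sub>F n in sequentially. C * (2 * inverse (real (Suc n))) < e"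
        using e by (intro order_tendstoD(2)[where a = e]) auto
      then obtain N where N: "C * (2 * inverse (real (Suc N))) < e"
        by (auto simp: eventually_sequentially)
      have "Q (simple_int \<mu> (s m) - simple_int \<mu> (s n)) < e" if "m \<ge> N" "n \<ge> N" for m n
      proof -
        have "Q (simple_int \<mu> (s m) - simple_int \<mu> (s n)) \<le>
            C * (inverse (real (Suc m)) + inverse (real (Suc n)))"
          by (rule C_diff[OF s s sf sf])
        also have "\<dots> \<le> C * (2 * inverse (real (Suc N)))"
        proof (rule mult_left_mono[OF _ C(1)])
          have "inverse (real (Suc m)) \<le> inverse (real (Suc N))"
            "inverse (real (Suc n)) \<le> inverse (real (Suc N))"
            using that by (simp_all add: le_imp_inverse_le)
          then show "inverse (real (Suc m)) + inverse (real (Suc n)) \<le> 2 * inverse (real (Suc N))"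
            by linarith
        qed
        finally show ?thesis using N by linarith
      qed
      then show "\<exists>N. \<forall>m\<ge>N. \<forall>n\<ge>N. Q (simple_int \<mu> (s m) - simple_int \<mu> (s n)) < e" by blast
    qed
    then obtain l where l: "(\<lambda>n. Q (simple_int \<mu> (s n) - l)) \<longlonglongrightarrow> 0" by blast
    have "Q (simple_int \<mu> t - l) \<le> K * C * d"
      if t: "simple_fun R t" and d: "\<And>x. \<bar>t x - f x\<bar> \<le> d" for t d
    proof (rule LIMSEQ_le_const)
      \<comment> \<open>The approximant \<open>t\<close> is compared with \<open>s n\<close>; the
        upper bounds so obtained for a fixed left side converge.\<close>
      show "(\<lambda>n. K * (C * (d + inverse (real (Suc n))) + Q (simple_int \<mu> (s n) - l))) \<longlonglongrightarrow> K * C * d"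
        by (rule tendsto_eq_intros LIMSEQ_inverse_real_of_nat l refl)+ simp
      show "\<exists>N. \<forall>n\<ge>N. Q (simple_int \<mu> t - l) \<le>
          K * (C * (d + inverse (real (Suc n))) + Q (simple_int \<mu> (s n) - l))"
      proof (intro exI allI impI)
        fix n
        show "Q (simple_int \<mu> t - l) \<le>
            K * (C * (d + inverse (real (Suc n))) + Q (simple_int \<mu> (s n) - l))"
          using triangle_le[OF C_diff[OF t s[of n] d sf] order_refl, of "simple_int \<mu> (s n) - l"]
          by simp
      qed
    qed
    then show ?thesis by blast
  qed
  then obtain S where S: "\<And>f s d. simple_limit R f \<Longrightarrow> simple_fun R s \<Longrightarrow>
      (\<And>x. \<bar>s x - f x\<bar> \<le> d) \<Longrightarrow> Q (simple_int \<mu> s - S f) \<le> K * C * d"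
    by metis
  then show ?thesis using that[of "K * C" S] C(1) K_ge_1 by simp
qed

text \<open>Integration is linear on simple functions and differs from \<open>S\<close> by at most a
  multiple of \<open>d\<close> on approximants within \<open>d\<close>. The errors in both
  identities vanish as \<open>d\<close> tends to 0.\<close>

lemma linear_extension:
  obtains S C where "0 \<le> C"
    "\<And>f s d. simple_limit R f \<Longrightarrow> simple_fun R s \<Longrightarrow> (\<And>x. \<bar>s x - f x\<bar> \<le> d) \<Longrightarrow>
      Q (simple_int \<mu> s - S f) \<le> C * d"
    "\<And>f g. simple_limit R f \<Longrightarrow> simple_limit R g \<Longrightarrow> simple_limit R (\<lambda>x. f x + g x) \<Longrightarrow>
      S (\<lambda>x. f x + g x) = S f + S g"
    "\<And>f a. simple_limit R f \<Longrightarrow> simple_limit R (\<lambda>x. a * f x) \<Longrightarrow> S (\<lambda>x. a * f x) = a *\<^sub>R S f"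
    "\<And>f b. simple_limit R f \<Longrightarrow> (\<And>x. \<bar>f x\<bar> \<le> b) \<Longrightarrow> Q (S f) \<le> C * b"
proof -
  obtain S C where C: "0 \<le> C" and S:
    "\<And>f s d. simple_limit R f \<Longrightarrow> simple_fun R s \<Longrightarrow> (\<And>x. \<bar>s x - f x\<bar> \<le> d) \<Longrightarrow>
      Q (simple_int \<mu> s - S f) \<le> C * d"
    by (rule extension_exists) blast
  let ?T = "simple_int \<mu>"
  have "S (\<lambda>x. f x + g x) = S f + S g"
    if f: "simple_limit R f" and g: "simple_limit R g" and fg: "simple_limit R (\<lambda>x. f x + g x)"
    for f g
  proof -
    have "Q (S f + S g - S (\<lambda>x. f x + g x)) \<le> (K * (K * (C + C) + C * 2)) * d" if d: "0 < d" for d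
    proof -
      obtain s t where s: "simple_fun R s" "\<And>x. \<bar>s x - f x\<bar> \<le> d"
        and t: "simple_fun R t" "\<And>x. \<bar>t x - g x\<bar> \<le> d"
        using f g d unfolding simple_limit_def by meson
      have st: "\<bar>(s x + t x) - (f x + g x)\<bar> \<le> 2 * d" for x using s(2)[of x] t(2)[of x] by linarith
      have 1: "Q ((?T s - S f) + (?T t - S g)) \<le> K * (C * d + C * d)"
        by (rule triangle_le[OF S[OF f s] S[OF g t]])
      have 2: "Q (?T (\<lambda>x. s x + t x) - S (\<lambda>x. f x + g x)) \<le> C * (2 * d)"
        by (rule S[OF fg simple_fun_add[OF s(1) t(1)] st])
      have "S f + S g - S (\<lambda>x. f x + g x) =
          (?T (\<lambda>x. s x + t x) - S (\<lambda>x. f x + g x)) - ((?T s - S f) + (?T t - S g))"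
        by (simp add: simple_int_add[OF additive s(1) t(1)])
      also have "Q \<dots> \<le> K * (C * (2 * d) + K * (C * d + C * d))"
        by (rule triangle_diff_le[OF 2 1])
      finally show ?thesis by (simp add: algebra_simps)
    qed
    then have "S f + S g - S (\<lambda>x. f x + g x) = 0" by (rule eq_zero_if_small)
    then show ?thesis by simp
  qed
  moreover have "S (\<lambda>x. a * f x) = a *\<^sub>R S f"
    if f: "simple_limit R f" and af: "simple_limit R (\<lambda>x. a * f x)" for f a
  proof -
    have "Q (a *\<^sub>R S f - S (\<lambda>x. a * f x)) \<le> (K * (C * \<bar>a\<bar> + \<bar>a\<bar> * C)) * d" if d: "0 < d" for d
    proof -
      obtain s where s: "simple_fun R s" "\<And>x. \<bar>s x - f x\<bar> \<le> d"
        using f d unfolding simple_limit_def by meson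
      have as: "\<bar>a * s x - a * f x\<bar> \<le> \<bar>a\<bar> * d" for x
        using mult_left_mono[OF s(2)[of x], of "\<bar>a\<bar>"]
        by (simp add: abs_mult[symmetric] right_diff_distrib)
      have 1: "Q (a *\<^sub>R (?T s - S f)) \<le> \<bar>a\<bar> * (C * d)"
        unfolding scale by (intro mult_left_mono S f s) simp
      have "simple_fun R (\<lambda>x. a * s x)" by (rule simple_fun_comp[OF s(1)]) simp
      then have 2: "Q (?T (\<lambda>x. a * s x) - S (\<lambda>x. a * f x)) \<le> C * (\<bar>a\<bar> * d)"
        by (rule S[OF af _ as])
      have "a *\<^sub>R S f - S (\<lambda>x. a * f x) =
          (?T (\<lambda>x. a * s x) - S (\<lambda>x. a * f x)) - a *\<^sub>R (?T s - S f)"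
        by (simp add: simple_int_scale[OF additive s(1)] algebra_simps)
      also have "Q \<dots> \<le> K * (C * (\<bar>a\<bar> * d) + \<bar>a\<bar> * (C * d))"
        by (rule triangle_diff_le[OF 2 1])
      finally show ?thesis by (simp add: algebra_simps)
    qed
    then have "a *\<^sub>R S f - S (\<lambda>x. a * f x) = 0" by (rule eq_zero_if_small)
    then show ?thesis by simp
  qed
  \<comment> \<open>The zero function is simple and approximates \<open>f\<close> within
    \<open>b\<close>.\<close>
  moreover have "Q (S f) \<le> C * b" if "simple_limit R f" "\<And>x. \<bar>f x\<bar> \<le> b" for f b
    using S[of f "\<lambda>x. 0" b] that empty by (simp add: simple_fun_def simple_int_def minus)
  ultimately show ?thesis using that C S by blast
qed

text \<open>Evaluation at points shows that \<open>q\<close> inverts integration on simple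
  functions. As \<open>q\<close> and \<open>S\<close> are bounded, \<open>q (S f) = f\<close> passes
  to uniform limits.\<close>

lemma bounded_section:
  fixes q :: "'z \<Rightarrow> 'a discrete \<Rightarrow>\<^sub>C real"
  assumes q: "linear q" and q_bound: "\<And>z. norm (q z) \<le> M * Q z"
    and q_\<mu>: "\<And>A i. A \<in> R \<Longrightarrow> apply_bcontfun (q (\<mu> A)) (discrete i) = indicator A i"
    and W: "subspace W" "\<And>f. f \<in> W \<Longrightarrow> simple_limit R (\<lambda>i. apply_bcontfun f (discrete i))"
  obtains S C where "0 \<le> C"
    "\<And>f g. f \<in> W \<Longrightarrow> g \<in> W \<Longrightarrow> S (f + g) = S f + S g"
    "\<And>f a. f \<in> W \<Longrightarrow> S (a *\<^sub>R f) = a *\<^sub>R S f"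
    "\<And>f. f \<in> W \<Longrightarrow> Q (S f) \<le> C * norm f"
    "\<And>f. f \<in> W \<Longrightarrow> q (S f) = f"
proof -
  obtain S C where C: "0 \<le> C" and S:
    "\<And>f s d. simple_limit R f \<Longrightarrow> simple_fun R s \<Longrightarrow> (\<And>x. \<bar>s x - f x\<bar> \<le> d) \<Longrightarrow>
      Q (simple_int \<mu> s - S f) \<le> C * d"
    and S_add: "\<And>f g. simple_limit R f \<Longrightarrow> simple_limit R g \<Longrightarrow> simple_limit R (\<lambda>x. f x + g x) \<Longrightarrow>
      S (\<lambda>x. f x + g x) = S f + S g"
    and S_scale: "\<And>f a. simple_limit R f \<Longrightarrow> simple_limit R (\<lambda>x. a * f x) \<Longrightarrow>
      S (\<lambda>x. a * f x) = a *\<^sub>R S f"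
    and S_bound: "\<And>f b. simple_limit R f \<Longrightarrow> (\<And>x. \<bar>f x\<bar> \<le> b) \<Longrightarrow> Q (S f) \<le> C * b"
    by (rule linear_extension) blast
  have M: "norm (q z) \<le> \<bar>M\<bar> * Q z" for z
    using q_bound[of z] mult_right_mono[OF abs_ge_self nonneg, of M z] by linarith
  have q_T: "apply_bcontfun (q (simple_int \<mu> s)) (discrete i) = s i" if s: "simple_fun R s" for s i
  proof -
    have lin: "linear (\<lambda>z. apply_bcontfun (q z) (discrete i))"
      using q by (intro linearI) (simp_all add: linear_add linear_scale)
    have fin: "finite (range s - {0})" using s by (simp add: simple_fun_def)
    have "apply_bcontfun (q (simple_int \<mu> s)) (discrete i) =
        (\<Sum>c\<in>range s - {0}. c * indicator (s -` {c}) i)"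
      unfolding simple_int_def linear_sum[OF lin]
      by (intro sum.cong refl) (simp add: linear_scale[OF q] q_\<mu> simple_fun_vimage[OF s])
    \<comment> \<open>If \<open>s i = 0\<close>, no index of the sum equals \<open>s i\<close>, and
      the empty contribution 0 is again \<open>s i\<close>.\<close>
    also have "\<dots> = (\<Sum>c\<in>range s - {0}. if c = s i then c else 0)"
      by (intro sum.cong refl) (auto simp: indicator_def)
    also have "\<dots> = s i" using fin by (simp add: sum.delta)
    finally show ?thesis .
  qed
  define S' where "S' f = S (\<lambda>i. apply_bcontfun f (discrete i))" for f
  have "S' (f + g) = S' f + S' g" if "f \<in> W" "g \<in> W" for f g
    using S_add[OF W(2) W(2), of f g] W(2)[OF subspace_add[OF W(1)], of f g] that
    by (simp add: S'_def)
  moreover have "S' (a *\<^sub>R f) = a *\<^sub>R S' f" if "f \<in> W" for f a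
    using S_scale[OF W(2), of f a] W(2)[OF subspace_scale[OF W(1)], of f a] that
    by (simp add: S'_def)
  moreover have "Q (S' f) \<le> C * norm f" if "f \<in> W" for f
    unfolding S'_def using norm_bounded[of f] by (intro S_bound W(2) that) simp
  moreover have "q (S' f) = f" if f: "f \<in> W" for f
  proof -
    have "norm (q (S' f) - f) \<le> 0 + e" if e: "0 < e" for e
    proof -
      \<comment> \<open>The error \<open>\<bar>M\<bar> * C * d\<close> due to \<open>S\<close> and
        the error \<open>d\<close> of the approximation of \<open>f\<close> add up to
        \<open>e\<close>.\<close>
      define d where "d = e / (\<bar>M\<bar> * C + 1)"
      have pos: "0 < \<bar>M\<bar> * C + 1" using C by (simp add: add_nonneg_pos)
      then have d: "0 < d" using e by (simp add: d_def)
      then obtain s where s: "simple_fun R s" "\<And>i. \<bar>s i - apply_bcontfun f (discrete i)\<bar> \<le> d"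
        using W(2)[OF f] unfolding simple_limit_def by blast
      have "norm (q (simple_int \<mu> s) - q (S' f)) \<le> \<bar>M\<bar> * Q (simple_int \<mu> s - S' f)"
        using M[of "simple_int \<mu> s - S' f"] by (simp add: linear_diff[OF q])
      also have "\<dots> \<le> \<bar>M\<bar> * (C * d)"
        unfolding S'_def by (intro mult_left_mono S W(2) f s) simp
      finally have "norm (q (simple_int \<mu> s) - q (S' f)) \<le> \<bar>M\<bar> * (C * d)" .
      moreover have "norm (q (simple_int \<mu> s) - f) \<le> d"
      proof (rule norm_bound)
        fix x
        show "norm (apply_bcontfun (q (simple_int \<mu> s) - f) x) \<le> d"
          using q_T[OF s(1)] s(2) by (cases x) simp
      qed
      ultimately have "norm (q (S' f) - f) \<le> \<bar>M\<bar> * (C * d) + d"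
        using norm_triangle_ineq4[of "q (simple_int \<mu> s) - f" "q (simple_int \<mu> s) - q (S' f)"]
        by (simp add: norm_minus_commute)
      also have "\<dots> = (\<bar>M\<bar> * C + 1) * d" by (simp add: algebra_simps)
      also have "\<dots> = e" using pos by (simp add: d_def)
      finally show ?thesis by simp
    qed
    then have "norm (q (S' f) - f) \<le> 0" by (rule field_le_epsilon)
    then show ?thesis by simp
  qed
  ultimately show ?thesis using that C by blast
qed

end

section \<open>Neighbourhoods of zero in F-spaces\<close>

abbreviation nhd0 :: "'z::f_space set \<Rightarrow> bool" where
  "nhd0 U \<equiv> \<forall>\<^sub>F z in nhds 0. z \<in> U"

definition balanced :: "'z::real_vector set \<Rightarrow> bool" where
  "balanced U \<longleftrightarrow> (\<forall>a z. \<bar>a\<bar> \<le> 1 \<longrightarrow> z \<in> U \<longrightarrow> a *\<^sub>R z \<in> U)"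

lemma balancedD: "balanced U \<Longrightarrow> \<bar>a\<bar> \<le> 1 \<Longrightarrow> z \<in> U \<Longrightarrow> a *\<^sub>R z \<in> U"
  by (simp add: balanced_def)

lemma balanced_minus: "balanced U \<Longrightarrow> z \<in> U \<Longrightarrow> - z \<in> U"
  using balancedD[of U "-1" z] by simp

lemma nhd0_Int: "nhd0 U \<Longrightarrow> nhd0 V \<Longrightarrow> nhd0 (U \<inter> V)"
  by (simp add: eventually_conj)

lemma nhd0_scale:
  assumes "nhd0 U"
  shows "\<forall>\<^sub>F z in nhds 0. c *\<^sub>R z \<in> U"
proof -
  have "LIM z nhds 0. (c, z) :> nhds c \<times>\<^sub>F nhds (0::'a)"
    by (intro filterlim_Pair tendsto_const filterlim_ident)
  from filterlim_compose[OF tendsto_scaleR_Pair this]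
  have "LIM z nhds (0::'a). c *\<^sub>R z :> nhds 0" by simp
  then show ?thesis using assms by (rule eventually_compose_filterlim[rotated])
qed

lemma nhd0_absorbs:
  assumes "nhd0 U"
  obtains e where "0 < e" "e *\<^sub>R z \<in> U"
proof -
  have "LIM a nhds 0. (a, z) :> nhds (0::real) \<times>\<^sub>F nhds z"
    by (intro filterlim_Pair tendsto_const filterlim_ident)
  from filterlim_compose[OF tendsto_scaleR_Pair this]
  have "LIM a nhds (0::real). a *\<^sub>R z :> nhds 0" by simp
  then have "\<forall>\<^sub>F a in nhds (0::real). a *\<^sub>R z \<in> U" using assms by (rule eventually_compose_filterlim[rotated])
  then obtain d where d: "0 < d" "\<And>a. dist a 0 < d \<Longrightarrow> a *\<^sub>R z \<in> U"
    by (auto simp: eventually_nhds_metric)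
  show ?thesis by (rule that[of "d / 2"]) (use d in auto)
qed

text \<open>Joint continuity of scaling at (0, 0) gives scalars below some \<open>d\<close> and a
  neighbourhood whose products lie in \<open>U\<close>; the set of all these products is
  balanced.\<close>

lemma nhd0_balanced:
  assumes "nhd0 U"
  obtains V where "nhd0 V" "balanced V" "V \<subseteq> U"
proof -
  have "LIM x (nhds (0::real) \<times>\<^sub>F nhds (0::'a)). fst x *\<^sub>R snd x :> nhds 0"
    using tendsto_scaleR_Pair[of 0 "0::'a"] by simp
  then have "\<forall>\<^sub>F x in nhds (0::real) \<times>\<^sub>F nhds (0::'a). fst x *\<^sub>R snd x \<in> U"
    using assms by (rule eventually_compose_filterlim[rotated])
  then obtain Pf Pg where Pf: "eventually Pf (nhds (0::real))" and Pg: "eventually Pg (nhds (0::'a))"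
    and P: "\<And>a z. Pf a \<Longrightarrow> Pg z \<Longrightarrow> a *\<^sub>R z \<in> U"
    by (auto simp: eventually_prod_filter)
  obtain d where d: "0 < d" "\<And>a. dist a 0 < d \<Longrightarrow> Pf a"
    using Pf by (auto simp: eventually_nhds_metric)
  define V where "V = {a *\<^sub>R z | a z. \<bar>a\<bar> < d \<and> Pg z}"
  have "balanced V"
    unfolding balanced_def
  proof (intro allI impI)
    fix b :: real and z assume b: "\<bar>b\<bar> \<le> 1" and "z \<in> V"
    then obtain a y where ay: "z = a *\<^sub>R y" "\<bar>a\<bar> < d" "Pg y" by (auto simp: V_def)
    have "\<bar>b * a\<bar> \<le> 1 * \<bar>a\<bar>" unfolding abs_mult by (rule mult_right_mono[OF b]) simp
    then have "\<bar>b * a\<bar> < d" using ay by linarith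
    then show "b *\<^sub>R z \<in> V" using ay by (auto simp: V_def)
  qed
  moreover have "V \<subseteq> U" using P d by (auto simp: V_def)
  \<comment> \<open>\<open>V\<close> contains the dilate by \<open>d / 2\<close> of the
    neighbourhood described by \<open>Pg\<close>.\<close>
  moreover have "\<forall>\<^sub>F z in nhds 0. (2 / d) *\<^sub>R z \<in> {z. Pg z}"
    by (rule nhd0_scale) (use Pg in simp)
  then have "nhd0 V"
  proof (rule eventually_mono)
    fix z assume "(2 / d) *\<^sub>R z \<in> {z. Pg z}"
    moreover have "z = (d / 2) *\<^sub>R (2 / d) *\<^sub>R z" using d by simp
    moreover have "\<bar>d / 2\<bar> < d" using d by simp
    ultimately show "z \<in> V" unfolding V_def by blast
  qed
  ultimately show ?thesis using that by blast
qed

lemma nhd0_add: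
  assumes "nhd0 U"
  obtains V where "nhd0 V" "balanced V" "\<And>x y. x \<in> V \<Longrightarrow> y \<in> V \<Longrightarrow> x + y \<in> U"
proof -
  have "LIM x (nhds (0::'a) \<times>\<^sub>F nhds (0::'a)). fst x + snd x :> nhds 0"
    using tendsto_add_Pair[of 0 "0::'a"] by simp
  then have "\<forall>\<^sub>F x in nhds (0::'a) \<times>\<^sub>F nhds (0::'a). fst x + snd x \<in> U"
    using assms by (rule eventually_compose_filterlim[rotated])
  then obtain Pf Pg where P: "eventually Pf (nhds (0::'a))" "eventually Pg (nhds (0::'a))"
    "\<And>x y. Pf x \<Longrightarrow> Pg y \<Longrightarrow> x + y \<in> U"
    by (auto simp: eventually_prod_filter)
  have "nhd0 {z. Pf z \<and> Pg z}" using P by (simp add: eventually_conj)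
  then obtain V where "nhd0 V" "balanced V" and V: "V \<subseteq> {z. Pf z \<and> Pg z}"
    by (rule nhd0_balanced)
  moreover have "x + y \<in> U" if "x \<in> V" "y \<in> V" for x y
    using that V by (intro P(3)) auto
  ultimately show ?thesis using that by blast
qed

section \<open>Continuity, separation and completeness in terms of neighbourhoods of zero\<close>

lemma linear_continuous_if_continuous_at_0:
  fixes f :: "'y::f_space \<Rightarrow> 'z::f_space"
  assumes "linear f" and "\<And>U. nhd0 U \<Longrightarrow> \<forall>\<^sub>F y in nhds 0. f y \<in> U"
  shows "continuous_on UNIV f"
  unfolding continuous_on_def
proof
  fix x :: 'y
  have f0: "(f \<longlongrightarrow> 0) (nhds 0)"
    unfolding filterlim_iff
  proof (intro allI impI)
    fix P assume "eventually P (nhds (0::'z))"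
    then show "\<forall>\<^sub>F y in nhds 0. P (f y)" using assms(2)[of "Collect P"] by simp
  qed
  have "((\<lambda>z. z + - x) \<longlongrightarrow> x + - x) (at x)"
    by (rule tendsto_add[OF tendsto_ident_at tendsto_const])
  then have "((\<lambda>z. z - x) \<longlongrightarrow> 0) (at x)" by simp
  from filterlim_compose[OF f0 this] have "((\<lambda>z. f x + f (z - x)) \<longlongrightarrow> f x + 0) (at x)"
    by (rule tendsto_add[OF tendsto_const])
  then show "(f \<longlongrightarrow> f x) (at x)" by (simp add: linear_diff[OF assms(1)])
qed

lemma f_space_separated:
  fixes z :: "'z::f_space"
  assumes "\<And>U. nhd0 U \<Longrightarrow> z \<in> U"
  shows "z = 0"
proof (rule ccontr)
  assume "z \<noteq> 0"
  obtain d :: "'z \<Rightarrow> 'z \<Rightarrow> real" where d: "Metric_space UNIV d"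
    "openin (Metric_space.mtopology UNIV d) = open"
    using complete_invariant_metric by blast
  interpret d: Metric_space UNIV d by (rule d)
  have "open (d.mball 0 (d 0 z))" using d.openin_mball[of 0 "d 0 z"] d(2) by simp
  moreover have "0 \<in> d.mball 0 (d 0 z)" using \<open>z \<noteq> 0\<close> by (simp add: d.mdist_pos_eq)
  ultimately have "nhd0 (d.mball 0 (d 0 z))" by (auto simp: eventually_nhds)
  from assms[OF this] show False by simp
qed

text \<open>Invariance of the metric turns the Cauchy condition on differences into the metric
  one.\<close>

lemma f_space_complete:
  fixes s :: "nat \<Rightarrow> 'z::f_space"
  assumes "\<And>U. nhd0 U \<Longrightarrow> \<exists>N. \<forall>m\<ge>N. \<forall>n\<ge>N. s m - s n \<in> U"
  obtains l where "\<And>U. nhd0 U \<Longrightarrow> \<forall>\<^sub>F n in sequentially. s n - l \<in> U"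
proof -
  obtain d :: "'z \<Rightarrow> 'z \<Rightarrow> real" where d: "Metric_space UNIV d" "\<And>x y z. d (x + z) (y + z) = d x y"
    "Metric_space.mcomplete UNIV d" "openin (Metric_space.mtopology UNIV d) = open"
    using complete_invariant_metric by blast
  interpret d: Metric_space UNIV d by (rule d)
  have "d.MCauchy s"
    unfolding d.MCauchy_def
  proof (intro conjI allI impI)
    fix e :: real assume e: "0 < e"
    have "open (d.mball 0 e)" using d.openin_mball[of 0 e] d(4) by simp
    moreover have "0 \<in> d.mball 0 e" using e by simp
    ultimately have "nhd0 (d.mball 0 e)" by (auto simp: eventually_nhds)
    then obtain N where "\<forall>m\<ge>N. \<forall>n\<ge>N. s m - s n \<in> d.mball 0 e" using assms by blast
    moreover have "d 0 (x - y) = d y x" for x y using d(2)[of 0 y "x - y"] by simp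
    ultimately show "\<exists>N. \<forall>n n'. N \<le> n \<longrightarrow> N \<le> n' \<longrightarrow> d (s n) (s n') < e" by auto
  qed simp
  then obtain l where l: "limitin d.mtopology s l sequentially"
    using d(3) by (auto simp: d.mcomplete_def)
  have "\<forall>\<^sub>F n in sequentially. s n - l \<in> U" if "nhd0 U" for U
  proof -
    obtain V where V: "open V" "0 \<in> V" "\<forall>x\<in>V. x \<in> U"
      using \<open>nhd0 U\<close> unfolding eventually_nhds by blast
    have "continuous_on UNIV (\<lambda>z. z + - l)" by (intro continuous_intros)
    then have "open ((\<lambda>z. z + - l) -` V)" using V(1) by (rule open_vimage[rotated])
    then have "openin d.mtopology ((\<lambda>z. z + - l) -` V)" by (simp add: d(4))
    then have "\<forall>\<^sub>F n in sequentially. s n \<in> (\<lambda>z. z + - l) -` V"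
      using l V(2) by (auto simp: limitin_def)
    then show ?thesis by (rule eventually_mono) (use V(3) in auto)
  qed
  then show ?thesis using that by blast
qed

text \<open>The quasi-norm is the Minkowski functional of \<open>B\<close>. Balancedness gives
  homogeneity, and boundedness makes its balls a base of neighbourhoods of zero. If V + V is
  contained in \<open>B\<close> and t B in V, then 1/t is a constant for the triangle
  inequality.\<close>

lemma minkowski_quasi_norm:
  fixes B :: "'z::f_space set"
  assumes B: "nhd0 B" "balanced B"
    and bounded: "\<And>U. nhd0 U \<Longrightarrow> \<exists>t>0. \<forall>b\<in>B. t *\<^sub>R b \<in> U"
  obtains Q K where "quasi_banach Q K"
    "\<And>U::'z set. nhd0 U \<Longrightarrow> \<exists>e>0. \<forall>z. Q z < e \<longrightarrow> z \<in> U"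
    "\<And>e. 0 < e \<Longrightarrow> nhd0 {z. Q z < e}"
proof -
  define T where "T z = {t. 0 < t \<and> inverse t *\<^sub>R z \<in> B}" for z
  define Q where "Q z = Inf (T z)" for z
  have bdd: "bdd_below (T z)" for z by (rule bdd_belowI[of _ 0]) (simp add: T_def)
  have ne: "T z \<noteq> {}" for z
  proof -
    obtain e where "0 < e" "e *\<^sub>R z \<in> B" by (rule nhd0_absorbs[OF B(1)])
    then have "inverse e \<in> T z" by (simp add: T_def)
    then show ?thesis by blast
  qed
  have Q_le: "Q z \<le> t" if "0 < t" "inverse t *\<^sub>R z \<in> B" for z t
    unfolding Q_def by (rule cInf_lower[OF _ bdd]) (simp add: T_def that)
  have Q0: "0 \<le> Q z" for z
    unfolding Q_def by (rule cInf_greatest[OF ne]) (simp add: T_def)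
  \<comment> \<open>Some \<open>s < t\<close> has \<open>inverse s *\<^sub>R z\<close> in
    \<open>B\<close>; balancedness carries this over to \<open>t\<close>.\<close>
  have Q_less: "inverse t *\<^sub>R z \<in> B" if z: "Q z < t" for z t
  proof -
    obtain s where s: "s \<in> T z" "s < t"
      using cInf_lessD[OF ne[of z] z[unfolded Q_def]] by blast
    then have "\<bar>s / t\<bar> \<le> 1" by (simp add: T_def)
    from balancedD[OF B(2) this, of "inverse s *\<^sub>R z"] s show ?thesis
      by (simp add: T_def field_simps)
  qed
  have small: "\<exists>e>0. \<forall>z. Q z < e \<longrightarrow> z \<in> U" if U: "nhd0 U" for U
  proof -
    obtain t where t: "t > 0" "\<And>b. b \<in> B \<Longrightarrow> t *\<^sub>R b \<in> U" using bounded[OF U] by blast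
    have "z \<in> U" if "Q z < t" for z using t(2)[OF Q_less[OF that]] t(1) by simp
    with t(1) show ?thesis by blast
  qed
  have nhd: "nhd0 {z. Q z < e}" if "0 < e" for e
    using nhd0_scale[OF B(1), of "2 / e"]
  proof (rule eventually_mono)
    fix z assume "(2 / e) *\<^sub>R z \<in> B"
    then have "Q z \<le> e / 2" using that by (intro Q_le) simp_all
    then show "z \<in> {z. Q z < e}" using that by simp
  qed
  have Q_scale_le: "Q (a *\<^sub>R z) \<le> \<bar>a\<bar> * Q z" for a z
  proof (rule field_le_epsilon)
    fix e :: real assume e: "0 < e"
    \<comment> \<open>The slack makes \<open>r\<close> strictly larger than \<open>Q z\<close>, yet
      multiplied by \<open>\<bar>a\<bar>\<close> it stays below \<open>e\<close>, also for
      \<open>a = 0\<close>.\<close>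
    define r where "r = Q z + e / (\<bar>a\<bar> + 1)"
    have a1: "0 < \<bar>a\<bar> + 1" by simp
    have r: "Q z < r" using e a1 by (simp add: r_def)
    have rpos: "0 < r" using r Q0[of z] by linarith
    define t where "t = \<bar>a\<bar> * Q z + e"
    have t: "0 < t" using e Q0[of z] by (simp add: t_def add_nonneg_pos)
    have "\<bar>a\<bar> * (e / (\<bar>a\<bar> + 1)) \<le> e" using e a1 by (simp add: field_simps)
    then have "\<bar>a\<bar> * r \<le> t" by (simp add: r_def t_def distrib_left)
    then have "\<bar>a * r / t\<bar> \<le> 1" using t rpos by (simp add: abs_mult)
    from balancedD[OF B(2) this Q_less[OF r]] have "inverse t *\<^sub>R a *\<^sub>R z \<in> B"
      using rpos by (simp add: field_simps)
    then show "Q (a *\<^sub>R z) \<le> \<bar>a\<bar> * Q z + e" using Q_le[OF t] by (simp add: t_def)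
  qed
  have Q_scale: "Q (a *\<^sub>R z) = \<bar>a\<bar> * Q z" for a z
  proof (cases "a = 0")
    case True
    then show ?thesis using Q_scale_le[of 0 z] Q0[of 0] by simp
  next
    case False
    have "Q (inverse a *\<^sub>R a *\<^sub>R z) \<le> \<bar>inverse a\<bar> * Q (a *\<^sub>R z)" by (rule Q_scale_le)
    then have "\<bar>a\<bar> * Q z \<le> Q (a *\<^sub>R z)" using False by (simp add: field_simps)
    with Q_scale_le[of a z] show ?thesis by linarith
  qed
  obtain V where V: "nhd0 V" "\<And>x y. x \<in> V \<Longrightarrow> y \<in> V \<Longrightarrow> x + y \<in> B"
    by (rule nhd0_add[OF B(1)]) blast
  obtain t where t: "t > 0" "\<And>b. b \<in> B \<Longrightarrow> t *\<^sub>R b \<in> V" using bounded[OF V(1)] by blast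
  define K where "K = max 1 (inverse t)"
  have tri: "Q (x + y) \<le> K * (Q x + Q y)" for x y
  proof -
    have "Q (x + y) \<le> inverse t * (Q x + Q y)"
    proof (rule field_le_epsilon)
      fix e :: real assume "0 < e"
      \<comment> \<open>The slack \<open>t * e\<close> becomes \<open>e\<close> under the final
        factor \<open>inverse t\<close>.\<close>
      define r where "r = Q x + Q y + t * e"
      have "Q x < r" "Q y < r" using Q0[of x] Q0[of y] \<open>0 < e\<close> t(1)
        by (auto simp: r_def add_pos_nonneg add_nonneg_pos intro: add_strict_increasing2)
      then have "t *\<^sub>R inverse r *\<^sub>R x + t *\<^sub>R inverse r *\<^sub>R y \<in> B" by (intro V(2) t(2) Q_less)
      then have "inverse (inverse t * r) *\<^sub>R (x + y) \<in> B" by (simp add: scaleR_add_right)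
      moreover have "0 < inverse t * r" using t(1) \<open>Q x < r\<close> Q0[of x] by simp
      ultimately have "Q (x + y) \<le> inverse t * r" by (intro Q_le)
      also have "\<dots> = inverse t * (Q x + Q y) + e" using t(1) by (simp add: r_def field_simps)
      finally show "Q (x + y) \<le> inverse t * (Q x + Q y) + e" .
    qed
    also have "\<dots> \<le> K * (Q x + Q y)"
      using Q0[of x] Q0[of y] by (intro mult_right_mono) (auto simp: K_def)
    finally show ?thesis .
  qed
  have "quasi_banach Q K"
  proof
    fix z assume "Q z = 0"
    show "z = 0"
    proof (rule f_space_separated)
      fix U :: "'z set" assume "nhd0 U"
      then show "z \<in> U" using small \<open>Q z = 0\<close> by force
    qed
  next
    fix s :: "nat \<Rightarrow> 'z"
    assume cauchy: "\<And>e. 0 < e \<Longrightarrow> \<exists>N. \<forall>m\<ge>N. \<forall>n\<ge>N. Q (s m - s n) < e"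
    have "\<exists>N. \<forall>m\<ge>N. \<forall>n\<ge>N. s m - s n \<in> U" if "nhd0 U" for U
      using small[OF that] cauchy by meson
    then obtain l where l: "\<And>U. nhd0 U \<Longrightarrow> \<forall>\<^sub>F n in sequentially. s n - l \<in> U"
      using f_space_complete by metis
    have "(\<lambda>n. Q (s n - l)) \<longlonglongrightarrow> 0"
      unfolding tendsto_iff using l[OF nhd] Q0 by simp
    then show "\<exists>l. (\<lambda>n. Q (s n - l)) \<longlonglongrightarrow> 0" by blast
  qed (use tri in \<open>auto simp: Q_scale K_def\<close>)
  then show ?thesis using small nhd that by blast
qed

text \<open>
  Local boundedness is a three-space property: for \<open>b\<close> in the neighbourhood below, openness of \<open>q\<close>
  provides a small \<open>u\<close> with \<open>q u = e q b\<close>, and \<open>e b - u\<close> then lies in the image of the unit ball.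
\<close>

lemma three_space_bounded_nhd0:
  fixes j :: "'x::real_normed_vector \<Rightarrow> 'z::f_space" and q :: "'z \<Rightarrow> 'w::real_normed_vector"
  assumes j: "linear j" and q: "linear q" and ker: "\<And>z. q z = 0 \<Longrightarrow> z \<in> range j"
    and j_cont: "\<And>U. nhd0 U \<Longrightarrow> \<exists>e>0. \<forall>x. norm x < e \<longrightarrow> j x \<in> U"
    and j_emb: "nhd0 {z. \<forall>x. z = j x \<longrightarrow> norm x < 1}"
    and q_cont: "nhd0 {z. norm (q z) < 1}"
    and q_open: "\<And>U. nhd0 U \<Longrightarrow> \<exists>e>0. \<forall>z. norm (q z) < e \<longrightarrow> q z \<in> q ` U"
  obtains B :: "'z set" where "nhd0 B" "balanced B" "\<And>U. nhd0 U \<Longrightarrow> \<exists>t>0. \<forall>b\<in>B. t *\<^sub>R b \<in> U"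
proof -
  obtain V where V: "nhd0 V" "balanced V" "\<And>x y. x \<in> V \<Longrightarrow> y \<in> V \<Longrightarrow> x + y \<in> {z. \<forall>u. z = j u \<longrightarrow> norm u < 1}"
    by (rule nhd0_add[OF j_emb]) blast
  define B where "B = V \<inter> {z. norm (q z) < 1}"
  have B1: "nhd0 B" unfolding B_def by (rule nhd0_Int[OF V(1) q_cont])
  have B2: "balanced B"
    unfolding balanced_def
  proof (intro allI impI)
    fix a :: real and z assume a: "\<bar>a\<bar> \<le> 1" and z: "z \<in> B"
    have "norm (q (a *\<^sub>R z)) \<le> 1 * norm (q z)"
      unfolding linear_scale[OF q] norm_scaleR using a by (intro mult_right_mono) auto
    then show "a *\<^sub>R z \<in> B" using balancedD[OF V(2) a] z by (auto simp: B_def)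
  qed
  have B3: "\<exists>t>0. \<forall>b\<in>B. t *\<^sub>R b \<in> U" if U: "nhd0 U" for U
  proof -
    obtain U' where U': "nhd0 U'" "balanced U'" "\<And>x y. x \<in> U' \<Longrightarrow> y \<in> U' \<Longrightarrow> x + y \<in> U"
      by (rule nhd0_add[OF U]) blast
    obtain e0 where e0: "0 < e0" "\<And>z. norm (q z) < e0 \<Longrightarrow> q z \<in> q ` (U' \<inter> V)"
      using q_open[OF nhd0_Int[OF U'(1) V(1)]] by blast
    obtain h0 where h0: "0 < h0" "\<And>x. norm x < h0 \<Longrightarrow> j x \<in> U'" using j_cont[OF U'(1)] by blast
    \<comment> \<open>The caps at 1 keep \<open>e\<close> times \<open>b\<close> in the balanced set
      \<open>V\<close> and \<open>h\<close> times \<open>u\<close> in the balanced set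
      \<open>U'\<close>. The factor \<open>h\<close> shrinks the open unit ball until
      \<open>j\<close> maps it into \<open>U'\<close>, so \<open>h * e\<close> is the required
      \<open>t\<close>.\<close>
    define e where "e = min 1 e0"
    define h where "h = min 1 h0"
    have eh: "0 < e" "e \<le> 1" "e \<le> e0" "0 < h" "h \<le> 1" "h \<le> h0"
      using e0(1) h0(1) by (auto simp: e_def h_def)
    have "(h * e) *\<^sub>R b \<in> U" if b: "b \<in> B" for b
    proof -
      have "norm (q (e *\<^sub>R b)) < e0"
      proof -
        have "norm (q (e *\<^sub>R b)) = e * norm (q b)" using eh by (simp add: linear_scale[OF q])
        also have "\<dots> < e * 1" using b eh by (intro mult_strict_left_mono) (auto simp: B_def)
        finally show ?thesis using eh by simp
      qed
      then obtain u where u: "u \<in> U'" "u \<in> V" "q (e *\<^sub>R b) = q u"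
        using e0(2)[of "e *\<^sub>R b"] by auto
      have "q (e *\<^sub>R b + - u) = 0" using u(3) by (simp add: linear_diff[OF q])
      then obtain x where x: "e *\<^sub>R b + - u = j x" using ker[of "e *\<^sub>R b + - u"] by auto
      have "e *\<^sub>R b \<in> V" using b eh by (auto simp: B_def intro: balancedD[OF V(2)])
      from V(3)[OF this balanced_minus[OF V(2) u(2)]] have "norm x < 1" by (simp only: x) simp
      then have "h * norm x < h * 1" by (rule mult_strict_left_mono[OF _ eh(4)])
      then have "norm (h *\<^sub>R x) < h0" using eh unfolding norm_scaleR by linarith
      then have "h *\<^sub>R j x \<in> U'" using h0(2)[of "h *\<^sub>R x"] by (simp add: linear_scale[OF j])
      moreover have "h *\<^sub>R u \<in> U'" using eh u by (intro balancedD[OF U'(2)]) auto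
      ultimately have "h *\<^sub>R j x + h *\<^sub>R u \<in> U" by (rule U'(3))
      moreover have "h *\<^sub>R j x + h *\<^sub>R u = (h * e) *\<^sub>R b"
        unfolding x[symmetric] by (simp add: scaleR_diff_right)
      ultimately show ?thesis by simp
    qed
    moreover have "0 < h * e" using eh by simp
    ultimately show ?thesis by blast
  qed
  show ?thesis by (rule that[OF B1 B2 B3])
qed

lemma nhd0I: "open U \<Longrightarrow> 0 \<in> U \<Longrightarrow> U \<subseteq> V \<Longrightarrow> nhd0 V"
  unfolding eventually_nhds by blast

section \<open>Continuous projections from approximation of almost additive set functions\<close>

text \<open>The quotient is replaced by one linear map \<open>q\<close> with kernel
  \<open>S\<close>. Openness is stated for values of \<open>q\<close> only, since \<open>q\<close>
  is open onto its range \<open>W\<close> but may fail to be open into the ambient space.\<close>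

lemma quotient_linear_homeo_map:
  fixes S :: "'z::f_space set" and W :: "'w::real_normed_vector set"
  assumes \<phi>: "quotient_linear_homeo S W \<phi>" and S: "subspace S"
  obtains q where "linear q" "range q = W" "\<And>z. q z = 0 \<longleftrightarrow> z \<in> S"
    "nhd0 {z. norm (q z) < 1}"
    "\<And>U. nhd0 U \<Longrightarrow> \<exists>e>0. \<forall>z. norm (q z) < e \<longrightarrow> q z \<in> q ` U"
proof -
  define p where "p = quotient_proj S"
  define q where "q = \<phi> \<circ> p"
  have h: "homeomorphic_map (quotient_topology S) (top_of_set W) \<phi>" and q: "linear q"
    using \<phi> by (auto simp: quotient_linear_homeo_def q_def p_def)
  have inj: "inj_on \<phi> (range p)" and im: "\<phi> ` range p = W"
    using homeomorphic_imp_injective_map[OF h] homeomorphic_imp_surjective_map[OF h]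
    by (simp_all add: topspace_quotient_topology p_def)
  have range_q: "range q = W" using im by (auto simp: q_def)
  have p_eq: "p x = p y \<longleftrightarrow> x - y \<in> S" for x y
  proof
    assume "p x = p y"
    moreover have "x + 0 \<in> p x"
      unfolding p_def quotient_proj_def by (rule imageI) (rule subspace_0[OF S])
    ultimately have "x \<in> p y" by simp
    then show "x - y \<in> S" by (auto simp: p_def quotient_proj_def)
  next
    have le: "p x \<subseteq> p y" if xy: "x - y \<in> S" for x y
    proof
      fix z assume "z \<in> p x"
      then obtain s where s: "s \<in> S" "z = x + s" by (auto simp: p_def quotient_proj_def)
      then have "z = y + ((x - y) + s)" by simp
      then show "z \<in> p y" unfolding p_def quotient_proj_def
        using subspace_add[OF S xy s(1)] by blast
    qed
    assume "x - y \<in> S"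
    moreover from subspace_neg[OF S this] have "y - x \<in> S" by simp
    ultimately show "p x = p y" using le by blast
  qed
  have ker: "q z = 0 \<longleftrightarrow> z \<in> S" for z
  proof -
    have "q z = 0 \<longleftrightarrow> \<phi> (p z) = \<phi> (p 0)" using linear_0[OF q] by (simp add: q_def)
    also have "\<dots> \<longleftrightarrow> z \<in> S" using inj_on_eq_iff[OF inj] p_eq[of z 0] by simp
    finally show ?thesis .
  qed
  have "continuous_map euclidean (quotient_topology S) p"
    unfolding p_def by (rule quotient_imp_continuous_map[OF quotient_map_quotient_proj])
  then have "continuous_map euclidean (top_of_set W) q"
    unfolding q_def by (rule continuous_map_compose[OF _ homeomorphic_imp_continuous_map[OF h]])
  then have "continuous_on UNIV q"
    by (simp add: continuous_map_into_subtopology continuous_map_in_subtopology)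
  then have "open (q -` ball 0 1)" by (rule open_vimage[OF open_ball])
  then have "nhd0 {z. norm (q z) < 1}"
    by (rule nhd0I) (auto simp: linear_0[OF q])
  moreover have "\<exists>e>0. \<forall>z. norm (q z) < e \<longrightarrow> q z \<in> q ` U" if U: "nhd0 U" for U
  proof -
    obtain O' where O': "open O'" "0 \<in> O'" "\<forall>x\<in>O'. x \<in> U"
      using U unfolding eventually_nhds by blast
    \<comment> \<open>The saturation of an open set is a union of translates by elements of
      \<open>S\<close>, hence open; so \<open>p\<close> is an open map.\<close>
    have "p -` (p ` O') = (\<Union>s\<in>S. (\<lambda>z. z + s) -` O')"
    proof (intro set_eqI iffI)
      fix z assume "z \<in> p -` (p ` O')"
      then obtain y where "y \<in> O'" "p y = p z" by (metis imageE vimageE)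
      then have "y - z \<in> S" "z + (y - z) \<in> O'" using p_eq by auto
      then show "z \<in> (\<Union>s\<in>S. (\<lambda>z. z + s) -` O')" by blast
    next
      fix z assume "z \<in> (\<Union>s\<in>S. (\<lambda>z. z + s) -` O')"
      then obtain s where s: "s \<in> S" "z + s \<in> O'" by auto
      then have "p z = p (z + s)" using p_eq[of "z + s" z] by simp
      then show "z \<in> p -` (p ` O')" using s by auto
    qed
    moreover have "open ((\<lambda>z. z + s) -` O')" for s
      by (rule open_vimage[OF O'(1)]) (intro continuous_intros)
    ultimately have "openin (quotient_topology S) (p ` O')"
      by (auto simp: openin_quotient_topology p_def)
    then have "openin (top_of_set W) (\<phi> ` p ` O')"
      using homeomorphic_imp_open_map[OF h] by (simp add: open_map_def)
    then have "openin (top_of_set W) (q ` O')" by (simp add: q_def image_comp)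
    then obtain T where T: "open T" "q ` O' = W \<inter> T" by (auto simp: openin_open)
    have "0 \<in> q ` O'" using O'(2) linear_0[OF q] by force
    then have "0 \<in> T" using T by auto
    then obtain e where e: "0 < e" "ball 0 e \<subseteq> T" using T(1) openE by blast
    have "q z \<in> q ` U" if "norm (q z) < e" for z
    proof -
      have "q z \<in> W \<inter> T" using that e(2) range_q by auto
      then show ?thesis using T(2) O'(3) by auto
    qed
    with e(1) show ?thesis by blast
  qed
  ultimately show ?thesis using that q range_q ker by blast
qed

text \<open>The second fact is continuity of the inverse of \<open>j\<close> at 0, phrased by a
  neighbourhood of zero in the ambient space, as the three-space argument uses it.\<close>

lemma linear_embedding_nhd0:
  fixes j :: "'x::real_normed_vector \<Rightarrow> 'z::f_space"
  assumes j: "linear j" and emb: "embedding_map euclidean euclidean j"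
  shows "nhd0 U \<Longrightarrow> \<exists>e>0. \<forall>x. norm x < e \<longrightarrow> j x \<in> U"
    and "nhd0 {z. \<forall>x. z = j x \<longrightarrow> norm x < 1}"
proof -
  have h: "homeomorphic_map euclidean (top_of_set (range j)) j"
    using emb by (simp add: embedding_map_def)
  have inj: "inj j" using homeomorphic_imp_injective_map[OF h] by simp
  have cont: "continuous_on UNIV j"
    using homeomorphic_imp_continuous_map[OF h] by (simp add: continuous_map_in_subtopology)
  show "\<exists>e>0. \<forall>x. norm x < e \<longrightarrow> j x \<in> U" if U: "nhd0 U"
  proof -
    obtain O' where O': "open O'" "0 \<in> O'" "\<forall>x\<in>O'. x \<in> U"
      using U unfolding eventually_nhds by blast
    have "open (j -` O')" by (rule open_vimage[OF O'(1) cont])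
    moreover have "0 \<in> j -` O'" using O'(2) linear_0[OF j] by simp
    ultimately obtain e where "0 < e" "ball 0 e \<subseteq> j -` O'" using openE by blast
    then show ?thesis using O'(3) by (intro exI[of _ e]) auto
  qed
  have "openin (top_of_set (range j)) (j ` ball 0 1)"
    using homeomorphic_imp_open_map[OF h] by (simp add: open_map_def)
  then obtain T where T: "open T" "j ` ball 0 1 = range j \<inter> T" by (auto simp: openin_open)
  have "0 \<in> j ` ball 0 1" using linear_0[OF j] by force
  then have "0 \<in> T" using T by auto
  with T(1) show "nhd0 {z. \<forall>x. z = j x \<longrightarrow> norm x < 1}"
  proof (rule nhd0I)
    show "T \<subseteq> {z. \<forall>x. z = j x \<longrightarrow> norm x < 1}"
    proof (clarify)
      fix x assume "j x \<in> T"
      then have "j x \<in> j ` ball 0 1" using T(2) by auto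
      then show "norm x < 1" using inj by (auto dest: injD)
    qed
  qed
qed

text \<open>Continuity at zero becomes an inequality by shrinking \<open>x\<close> to
  \<open>x / r\<close>, where \<open>p\<close> is below \<open>e\<close>. The summand
  \<open>d\<close> of \<open>r\<close> covers \<open>p x = 0\<close>.\<close>

lemma homogeneous_bound:
  fixes p q :: "'a::real_vector \<Rightarrow> real"
  assumes p: "\<And>a x. p (a *\<^sub>R x) = \<bar>a\<bar> * p x" "\<And>x. 0 \<le> p x"
    and q: "\<And>a x. q (a *\<^sub>R x) = \<bar>a\<bar> * q x"
    and e: "0 < e" "\<And>x. p x < e \<Longrightarrow> q x < 1"
  shows "q x \<le> 2 / e * p x"
proof (rule field_le_epsilon)
  fix d :: real assume d: "0 < d"
  define r where "r = 2 / e * p x + d"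
  have r: "0 < r" using d e(1) p(2)[of x] by (simp add: r_def add_nonneg_pos)
  have "p ((1 / r) *\<^sub>R x) = p x / r" using r by (simp add: p(1))
  also have "\<dots> < e"
  proof -
    have "p x \<le> e / 2 * r" using e(1) d by (simp add: r_def field_simps)
    also have "\<dots> < e * r" using e(1) r by simp
    finally show ?thesis using r by (simp add: field_simps)
  qed
  finally have "q ((1 / r) *\<^sub>R x) < 1" by (rule e(2))
  then have "q x < r" using r by (simp add: q field_simps)
  then show "q x \<le> 2 / e * p x + d" by (simp add: r_def)
qed

text \<open>A common form of both spaces: all subsets of a set give its bounded functions, the
  finite subsets its null functions.\<close>

definition level_space :: "'i set set \<Rightarrow> ('i discrete \<Rightarrow>\<^sub>C real) set" where
  "level_space R = {f. \<forall>d>0. {i. d \<le> \<bar>apply_bcontfun f (discrete i)\<bar>} \<in> R}"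

lemma indicator_bcontfun:
  obtains f :: "'i discrete \<Rightarrow>\<^sub>C real" where "\<And>i. apply_bcontfun f (discrete i) = indicator A i"
proof -
  have "range (indicator A :: 'i \<Rightarrow> real) \<subseteq> {0, 1}" by (auto simp: indicator_def)
  then have "(indicator A :: 'i \<Rightarrow> real) \<in> {f. bounded (range f)}"
    by (auto intro: bounded_subset[of "{0, 1}"])
  then obtain f :: "'i discrete \<Rightarrow>\<^sub>C real" where "indicator A = (\<lambda>i. apply_bcontfun f (discrete i))"
    unfolding bounded_functions_discrete[symmetric] by auto
  then show ?thesis using that[of f] by metis
qed

text \<open>The SVM property enters only through \<open>stable\<close>, where \<open>v\<close> may
  depend on \<open>\<nu>\<close> because a single set function is approximated for each extension.
  The bounded linear section \<open>S\<close> of \<open>q\<close> yields the projection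
  \<open>y - S (q y)\<close> onto the kernel of \<open>q\<close>.\<close>

lemma pair_splits_level_space:
  fixes R :: "'i set set"
  assumes R: "set_ideal R" and W: "subspace (level_space R)"
    and stable: "\<And>\<nu> :: 'i set \<Rightarrow> 'x.
      (\<And>A B. A \<in> R \<Longrightarrow> B \<in> R \<Longrightarrow> A \<inter> B = {} \<Longrightarrow> norm (\<nu> (A \<union> B) - \<nu> A - \<nu> B) \<le> 1) \<Longrightarrow>
      \<exists>\<mu> v. Measure_Space.additive R \<mu> \<and> (\<forall>A\<in>R. norm (\<nu> A - \<mu> A) \<le> v)"
  shows "pair_splits (level_space R) TYPE('x::banach) TYPE('z::f_space)"
  unfolding pair_splits_def
proof (intro allI impI, elim exE)
  fix j :: "'x \<Rightarrow> 'z" and \<phi>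
  assume j: "linear j" and emb: "embedding_map euclidean euclidean j"
    and \<phi>: "quotient_linear_homeo (range j) (level_space R) \<phi>"
  interpret set_ideal R by (rule R)
  note j_emb = linear_embedding_nhd0[OF j emb]
  obtain q where q: "linear q" and range_q: "range q = level_space R"
    and ker: "\<And>z. q z = 0 \<longleftrightarrow> z \<in> range j" and q_cont: "nhd0 {z. norm (q z) < 1}"
    and q_open: "\<And>U. nhd0 U \<Longrightarrow> \<exists>e>0. \<forall>z. norm (q z) < e \<longrightarrow> q z \<in> q ` U"
    by (rule quotient_linear_homeo_map[OF \<phi> linear_subspace_image[OF j subspace_UNIV]]) blast
  obtain B :: "'z set" where B: "nhd0 B" "balanced B"
    "\<And>U. nhd0 U \<Longrightarrow> \<exists>t>0. \<forall>b\<in>B. t *\<^sub>R b \<in> U"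
    by (rule three_space_bounded_nhd0[OF j q _ j_emb(1,2) q_cont q_open]) (use ker in blast)+
  obtain Q :: "'z \<Rightarrow> real" and K where "quasi_banach Q K"
    and Q_small: "\<And>U::'z set. nhd0 U \<Longrightarrow> \<exists>e>0. \<forall>z. Q z < e \<longrightarrow> z \<in> U"
    and Q_nhd: "\<And>e. 0 < e \<Longrightarrow> nhd0 {z. Q z < e}"
    by (rule minkowski_quasi_norm[OF B that])
  interpret quasi_banach Q K by fact
  \<comment> \<open>\<open>m1\<close> and \<open>m2\<close> make \<open>j\<close> an isomorphism
    onto its range, \<open>m3\<close> bounds \<open>q\<close>, and \<open>m4\<close> bounds suitable
    lifts of the unit ball, by openness of \<open>q\<close>.\<close>
  obtain m1 where m1: "\<And>x. norm x \<le> m1 * Q (j x)" "0 \<le> m1"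
  proof -
    obtain e where e: "e > 0" "\<And>z. Q z < e \<Longrightarrow> \<forall>x. z = j x \<longrightarrow> norm x < 1"
      using Q_small[OF j_emb(2)] by blast
    have "norm x \<le> 2 / e * Q (j x)" for x
      using e nonneg by (intro homogeneous_bound[where q = norm]) (auto simp: linear_scale[OF j] scale)
    then show ?thesis using that[of "2 / e"] e(1) by simp
  qed
  obtain m2 where m2: "\<And>x. Q (j x) \<le> m2 * norm x" "0 \<le> m2"
  proof -
    obtain e where e: "e > 0" "\<And>x. norm x < e \<Longrightarrow> j x \<in> {z. Q z < 1}"
      using j_emb(1)[OF Q_nhd[of 1]] by auto
    have "Q (j x) \<le> 2 / e * norm x" for x
      using e by (intro homogeneous_bound[where p = norm]) (auto simp: linear_scale[OF j] scale)
    then show ?thesis using that[of "2 / e"] e(1) by simp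
  qed
  obtain m3 where m3: "\<And>z. norm (q z) \<le> m3 * Q z" "0 \<le> m3"
  proof -
    obtain e where e: "e > 0" "\<And>z. Q z < e \<Longrightarrow> z \<in> {z. norm (q z) < 1}"
      using Q_small[OF q_cont] by auto
    have "norm (q z) \<le> 2 / e * Q z" for z
      using e nonneg by (intro homogeneous_bound[where p = Q]) (auto simp: linear_scale[OF q] scale)
    then show ?thesis using that[of "2 / e"] e(1) by simp
  qed
  obtain m4 where m4: "\<And>w. w \<in> level_space R \<Longrightarrow> norm w \<le> 1 \<Longrightarrow> \<exists>z. q z = w \<and> Q z \<le> m4" "0 \<le> m4"
  proof -
    obtain e where e: "e > 0" "\<And>z. norm (q z) < e \<Longrightarrow> q z \<in> q ` {z. Q z < 1}"
      using q_open[OF Q_nhd[of 1]] by auto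
    have "\<exists>z. q z = w \<and> Q z \<le> 2 / e" if w: "w \<in> level_space R" "norm w \<le> 1" for w
    proof -
      obtain z0 where z0: "q z0 = w" using w(1) unfolding range_q[symmetric] by auto
      have "norm (q ((e / 2) *\<^sub>R z0)) = e / 2 * norm w"
        using e(1) by (simp add: linear_scale[OF q] z0)
      also have "\<dots> \<le> e / 2 * 1" using e(1) w(2) by (intro mult_left_mono) auto
      also have "\<dots> < e" using e(1) by simp
      finally obtain u where u: "Q u < 1" "q u = (e / 2) *\<^sub>R w"
        using e(2)[of "(e / 2) *\<^sub>R z0"] by (auto simp: linear_scale[OF q] z0)
      have "Q ((2 / e) *\<^sub>R u) = 2 / e * Q u" using e(1) by (simp add: scale)
      also have "\<dots> \<le> 2 / e * 1" using e(1) u(1) by (intro mult_left_mono) auto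
      finally have "q ((2 / e) *\<^sub>R u) = w \<and> Q ((2 / e) *\<^sub>R u) \<le> 2 / e"
        using e(1) by (simp add: linear_scale[OF q] u(2))
      then show ?thesis by blast
    qed
    then show ?thesis using that[of "2 / e"] e(1) by simp
  qed
  have "\<exists>f :: 'i discrete \<Rightarrow>\<^sub>C real. \<forall>i. apply_bcontfun f (discrete i) = indicator A i" for A :: "'i set"
    by (rule indicator_bcontfun) blast
  then obtain ind :: "'i set \<Rightarrow> 'i discrete \<Rightarrow>\<^sub>C real"
    where ind: "\<And>A i. apply_bcontfun (ind A) (discrete i) = indicator A i" by metis
  have ind_W: "ind A \<in> level_space R" if "A \<in> R" for A
    unfolding level_space_def
  proof (intro CollectI allI impI)
    fix d :: real assume "0 < d"
    then have "{i. d \<le> \<bar>apply_bcontfun (ind A) (discrete i)\<bar>} \<subseteq> A"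
      by (auto simp: ind indicator_def split: if_splits)
    then show "{i. d \<le> \<bar>apply_bcontfun (ind A) (discrete i)\<bar>} \<in> R" by (rule subset[OF that])
  qed
  have ind_norm: "norm (ind A) \<le> 1" for A
  proof (rule norm_bound)
    fix x show "norm (apply_bcontfun (ind A) x) \<le> 1" by (cases x) (simp add: ind)
  qed
  have ind_Un: "ind (A \<union> B) = ind A + ind B" if "A \<inter> B = {}" for A B
  proof (rule bcontfun_eqI)
    fix x show "apply_bcontfun (ind (A \<union> B)) x = apply_bcontfun (ind A + ind B) x"
      using that by (cases x) (auto simp: ind indicator_def)
  qed
  obtain z where qz: "\<And>A. A \<in> R \<Longrightarrow> q (z A) = ind A" and Qz: "\<And>A. A \<in> R \<Longrightarrow> Q (z A) \<le> m4"
    using m4(1)[OF ind_W ind_norm] by metis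
  obtain L where L: "linear L" and qL: "\<And>w. w \<in> level_space R \<Longrightarrow> q (L w) = w"
    using linear_exists_right_inverse_on[OF q subspace_UNIV] range_q by auto
  have "\<exists>x. A \<in> R \<longrightarrow> j x = z A - L (ind A)" for A
  proof (cases "A \<in> R")
    case True
    then have "q (z A - L (ind A)) = 0" by (simp add: linear_diff[OF q] qz qL ind_W)
    then have "z A - L (ind A) \<in> range j" by (simp add: ker)
    then show ?thesis by (metis imageE)
  qed simp
  then obtain \<nu> where \<nu>: "\<And>A. A \<in> R \<Longrightarrow> j (\<nu> A) = z A - L (ind A)" by metis
  \<comment> \<open>In the defect of \<open>\<nu>\<close> the terms with \<open>L\<close> cancel.
    Three lifts bounded by \<open>m4\<close> remain, combined by two quasi-triangle inequalities;
    \<open>m1\<close> leads back to the norm of the Banach space, and 1 is added so that division by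
    \<open>c\<close> is possible.\<close>
  define c where "c = m1 * (K * (K * (m4 + m4) + m4)) + 1"
  have c: "0 < c" using m1(2) m4(2) K_ge_1 by (simp add: c_def add_nonneg_pos)
  have \<nu>_c: "norm (\<nu> (A \<union> B) - \<nu> A - \<nu> B) \<le> c" if AB: "A \<in> R" "B \<in> R" "A \<inter> B = {}" for A B
  proof -
    have "j (\<nu> (A \<union> B) - \<nu> A - \<nu> B) = z (A \<union> B) - z A - z B"
      using AB Un[OF AB(1,2)] by (simp add: linear_diff[OF j] \<nu> ind_Un linear_add[OF L])
    also have "Q \<dots> \<le> K * (K * (m4 + m4) + m4)"
      using AB Un[OF AB(1,2)] by (intro triangle_diff_le Qz)
    finally have "m1 * Q (j (\<nu> (A \<union> B) - \<nu> A - \<nu> B)) \<le> m1 * (K * (K * (m4 + m4) + m4))"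
      by (rule mult_left_mono[OF _ m1(2)])
    then show ?thesis using m1(1)[of "\<nu> (A \<union> B) - \<nu> A - \<nu> B"] by (simp add: c_def)
  qed
  have "norm ((1 / c) *\<^sub>R \<nu> (A \<union> B) - (1 / c) *\<^sub>R \<nu> A - (1 / c) *\<^sub>R \<nu> B) \<le> 1"
    if AB: "A \<in> R" "B \<in> R" "A \<inter> B = {}" for A B
  proof -
    have "norm ((1 / c) *\<^sub>R \<nu> (A \<union> B) - (1 / c) *\<^sub>R \<nu> A - (1 / c) *\<^sub>R \<nu> B) =
        norm (\<nu> (A \<union> B) - \<nu> A - \<nu> B) / c"
      using c by (simp add: scaleR_diff_right[symmetric])
    then show ?thesis using \<nu>_c[OF AB] c by simp
  qed
  \<comment> \<open>\<open>stable\<close> is normalised to defect 1; the factor \<open>1 / c\<close>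
    is undone in the definition of \<open>\<rho>\<close>.\<close>
  from stable[of "\<lambda>A. (1 / c) *\<^sub>R \<nu> A", OF this]
  obtain \<mu> :: "'i set \<Rightarrow> 'x" and v where \<mu>: "Measure_Space.additive R \<mu>"
    and v: "\<And>A. A \<in> R \<Longrightarrow> norm ((1 / c) *\<^sub>R \<nu> A - \<mu> A) \<le> v"
    by blast
  define \<rho> where "\<rho> A = L (ind A) + j (c *\<^sub>R \<mu> A)" for A
  have \<rho>: "bounded_additive Q K R \<rho> (K * (m4 + m2 * (c * v)))"
  proof
    show "Measure_Space.additive R \<rho>"
      using \<mu> unfolding Measure_Space.additive_def
      by (auto simp: \<rho>_def ind_Un linear_add[OF L] linear_add[OF j] scaleR_add_right)
  next
    fix A assume A: "A \<in> R"
    have "norm (\<nu> A - c *\<^sub>R \<mu> A) = c * norm ((1 / c) *\<^sub>R \<nu> A - \<mu> A)"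
    proof -
      have "\<nu> A - c *\<^sub>R \<mu> A = c *\<^sub>R ((1 / c) *\<^sub>R \<nu> A - \<mu> A)"
        using c by (simp add: scaleR_diff_right)
      then show ?thesis using c by simp
    qed
    also have "\<dots> \<le> c * v" using c v[OF A] by (intro mult_left_mono) auto
    finally have "Q (j (\<nu> A - c *\<^sub>R \<mu> A)) \<le> m2 * (c * v)"
      using m2 by (meson mult_left_mono order_trans)
    \<comment> \<open>The discontinuous \<open>L\<close> has cancelled: \<open>\<rho> A\<close> is
      the bounded lift \<open>z A\<close> up to the image of a bounded error.\<close>
    moreover have "\<rho> A = z A - j (\<nu> A - c *\<^sub>R \<mu> A)"
      by (simp add: \<rho>_def linear_diff[OF j] \<nu> A)
    ultimately show "Q (\<rho> A) \<le> K * (m4 + m2 * (c * v))"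
      using triangle_diff_le[OF Qz[OF A]] by simp
  qed
  have q_\<rho>: "apply_bcontfun (q (\<rho> A)) (discrete i) = indicator A i" if "A \<in> R" for A i
  proof -
    have "q (j x) = 0" for x by (simp add: ker)
    then have "q (\<rho> A) = ind A" using that by (simp add: \<rho>_def linear_add[OF q] qL ind_W)
    then show ?thesis by (simp add: ind)
  qed
  have lim: "simple_limit R (\<lambda>i. apply_bcontfun f (discrete i))" if "f \<in> level_space R" for f
  proof (rule simple_limitI)
    show "bounded (range (\<lambda>i. apply_bcontfun f (discrete i)))"
      by (rule bounded_subset[OF bounded_apply_bcontfun[of f]]) auto
  qed (use that in \<open>simp add: level_space_def\<close>)
  obtain S C where C: "0 \<le> C"
    and S: "\<And>f g. f \<in> level_space R \<Longrightarrow> g \<in> level_space R \<Longrightarrow> S (f + g) = S f + S g"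
      "\<And>f a. f \<in> level_space R \<Longrightarrow> S (a *\<^sub>R f) = a *\<^sub>R S f"
      "\<And>f. f \<in> level_space R \<Longrightarrow> Q (S f) \<le> C * norm f"
      "\<And>f. f \<in> level_space R \<Longrightarrow> q (S f) = f"
    by (rule bounded_additive.bounded_section[OF \<rho> q m3(1) q_\<rho> W lim]) blast+
  have qW: "q y \<in> level_space R" for y using range_q by auto
  define P where "P y = y - S (q y)" for y
  have P: "linear P"
    by (rule linearI) (simp_all add: P_def linear_add[OF q] linear_scale[OF q] S qW scaleR_diff_right)
  have P_range: "P y \<in> range j" for y
    by (simp add: ker[symmetric] P_def linear_diff[OF q] S qW)
  have P_j: "P y = y" if "y \<in> range j" for y
  proof -
    \<comment> \<open>Homogeneity of \<open>S\<close> with the scalar 0 gives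
      \<open>S 0 = 0\<close>.\<close>
    have "q y = 0 *\<^sub>R q y" using that ker[of y] by simp
    then have "S (q y) = 0" using S(2)[OF qW, of 0 y] by simp
    then show ?thesis by (simp add: P_def)
  qed
  have P_bound: "Q (P y) \<le> K * (1 + C * m3) * Q y" for y
  proof -
    have "Q (S (q y)) \<le> C * (m3 * Q y)"
      using S(3)[OF qW, of y] mult_left_mono[OF m3(1) C, of y] by linarith
    from triangle_diff_le[OF order_refl this, of y] show ?thesis
      by (simp add: P_def algebra_simps)
  qed
  have "continuous_on UNIV P"
  proof (rule linear_continuous_if_continuous_at_0[OF P])
    fix U :: "'z set" assume "nhd0 U"
    then obtain e where e: "0 < e" "\<And>y. Q y < e \<Longrightarrow> y \<in> U" using Q_small by blast
    define D where "D = K * (1 + C * m3)"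
    have D: "0 < D" using K_ge_1 C m3(2) by (simp add: D_def add_pos_nonneg)
    have "nhd0 {y. Q y < e / D}" using e D by (intro Q_nhd) simp
    then show "\<forall>\<^sub>F y in nhds 0. P y \<in> U"
    proof (rule eventually_mono)
      fix y assume "y \<in> {y. Q y < e / D}"
      then have "D * Q y < e" using D by (simp add: field_simps)
      then show "P y \<in> U" using P_bound[of y] by (intro e(2)) (simp add: D_def)
    qed
  qed
  moreover have "range P = range j"
  proof
    show "range j \<subseteq> range P" using rangeI[of P] P_j by (metis subsetI)
  qed (use P_range in auto)
  ultimately show "\<exists>P. linear P \<and> continuous_on UNIV P \<and> (\<forall>z. P (P z) = P z) \<and> range P = range j"
    using P P_j[OF P_range] by blast
qed

section \<open>All subsets and finite subsets\<close>

lemma set_ideal_Pow: "set_ideal (Pow \<Omega>)"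
  by unfold_locales auto

lemma set_ideal_Fpow: "set_ideal (Fpow \<Omega>)"
proof
  show "B \<in> Fpow \<Omega>" if "A \<in> Fpow \<Omega>" "B \<subseteq> A" for A B
    using that finite_subset[OF that(2)] by (auto simp: Fpow_def)
qed (auto simp: Fpow_def)

lemma level_space_Pow: "level_space (Pow \<Omega>) = linf \<Omega>"
proof (intro set_eqI iffI)
  fix f assume f: "f \<in> level_space (Pow \<Omega>)"
  have "apply_bcontfun f (discrete i) = 0" if "i \<notin> \<Omega>" for i
  proof (rule ccontr)
    assume "apply_bcontfun f (discrete i) \<noteq> 0"
    \<comment> \<open>The level is chosen as the modulus at \<open>i\<close>, so that
      \<open>i\<close> itself belongs to the level set.\<close>
    then have "{k. \<bar>apply_bcontfun f (discrete i)\<bar> \<le> \<bar>apply_bcontfun f (discrete k)\<bar>} \<subseteq> \<Omega>"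
      using f unfolding level_space_def by (simp del: subset_iff)
    then show False using that by auto
  qed
  then show "f \<in> linf \<Omega>" by (simp add: linf_def)
next
  fix f assume "f \<in> linf \<Omega>"
  then have "i \<in> \<Omega>" if "0 < d" "d \<le> \<bar>apply_bcontfun f (discrete i)\<bar>" for d i
    using that by (force simp: linf_def)
  then show "f \<in> level_space (Pow \<Omega>)" by (auto simp: level_space_def)
qed

lemma level_space_Fpow: "level_space (Fpow \<Omega>) = c0 \<Omega>"
proof -
  have "level_space (Fpow \<Omega>) \<subseteq> level_space (Pow \<Omega>)"
    by (auto simp: level_space_def Fpow_def)
  then have sub: "level_space (Fpow \<Omega>) \<subseteq> linf \<Omega>" by (simp add: level_space_Pow)
  have "f \<in> level_space (Fpow \<Omega>) \<longleftrightarrow> f \<in> c0 \<Omega>" if f: "f \<in> linf \<Omega>" for f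
  proof -
    have "{i. d \<le> \<bar>apply_bcontfun f (discrete i)\<bar>} =
        {i \<in> \<Omega>. \<bar>apply_bcontfun f (discrete i)\<bar> \<ge> d}" if "0 < d" for d
      using f that by (force simp: linf_def)
    then show ?thesis using f by (auto simp: level_space_def c0_def Fpow_def)
  qed
  then show ?thesis using sub by (auto simp: c0_def)
qed

text \<open>Sets are sorted by size: those with n + 1 elements arise by inserting a point into those
  with n elements, and an infinite cardinal absorbs the product as well as the countable
  union.\<close>

lemma card_of_Fpow_infinite:
  assumes inf: "infinite \<Omega>"
  shows "|Fpow \<Omega>| \<le>o |\<Omega>|"
proof -
  define D where "D n = {A. A \<subseteq> \<Omega> \<and> finite A \<and> card A = n}" for n
  have "|D n| \<le>o |\<Omega>|" for n
  proof (induction n)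
    case 0
    have "D 0 \<subseteq> {{}}" by (auto simp: D_def)
    then have "|D 0| \<le>o |{{} :: 'a set}|" by (rule card_of_mono1)
    also have "|{{} :: 'a set}| \<le>o |\<Omega>|"
      using inf by (intro card_of_singl_ordLeq) auto
    finally show ?case .
  next
    case (Suc n)
    have "D (Suc n) \<subseteq> (\<lambda>(x, A). insert x A) ` (\<Omega> \<times> D n)"
    proof
      fix A assume A: "A \<in> D (Suc n)"
      then obtain x where x: "x \<in> A" by (fastforce simp: D_def)
      then have "A - {x} \<in> D n" "x \<in> \<Omega>" "insert x (A - {x}) = A" using A by (auto simp: D_def)
      then show "A \<in> (\<lambda>(x, A). insert x A) ` (\<Omega> \<times> D n)"
        by (intro image_eqI[of _ _ "(x, A - {x})"]) auto
    qed
    then have "|D (Suc n)| \<le>o |(\<lambda>(x, A). insert x A) ` (\<Omega> \<times> D n)|" by (rule card_of_mono1)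
    also have "|(\<lambda>(x, A). insert x A) ` (\<Omega> \<times> D n)| \<le>o |\<Omega> \<times> D n|" by (rule card_of_image)
    also have "|\<Omega> \<times> D n| \<le>o |\<Omega>|"
      by (rule card_of_Sigma_ordLeq_infinite[OF inf]) (use Suc in \<open>auto intro: card_of_mono1\<close>)
    finally show ?case .
  qed
  then have "|\<Union>n\<in>UNIV. D n| \<le>o |\<Omega>|"
    using inf by (intro card_of_UNION_ordLeq_infinite) (auto simp: infinite_iff_card_of_nat)
  moreover have "Fpow \<Omega> = (\<Union>n\<in>UNIV. D n)" by (auto simp: Fpow_def D_def)
  ultimately show ?thesis by simp
qed

lemma algebra_finite_cofinite: "algebra \<Omega> {A. A \<subseteq> \<Omega> \<and> (finite A \<or> finite (\<Omega> - A))}"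
  unfolding algebra_iff_Un
proof (intro conjI ballI)
  fix A B assume "A \<in> {A. A \<subseteq> \<Omega> \<and> (finite A \<or> finite (\<Omega> - A))}"
    "B \<in> {A. A \<subseteq> \<Omega> \<and> (finite A \<or> finite (\<Omega> - A))}"
  then show "A \<union> B \<in> {A. A \<subseteq> \<Omega> \<and> (finite A \<or> finite (\<Omega> - A))}"
    by (auto intro: finite_subset[of "\<Omega> - (A \<union> B)" "\<Omega> - A"] finite_subset[of "\<Omega> - (A \<union> B)" "\<Omega> - B"])
next
  fix A assume "A \<in> {A. A \<subseteq> \<Omega> \<and> (finite A \<or> finite (\<Omega> - A))}"
  moreover from this have "\<Omega> - (\<Omega> - A) = A" by blast
  ultimately show "\<Omega> - A \<in> {A. A \<subseteq> \<Omega> \<and> (finite A \<or> finite (\<Omega> - A))}" by auto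
qed auto

lemma card_of_finite_cofinite:
  assumes inf: "infinite \<Omega>"
  shows "|{A. A \<subseteq> \<Omega> \<and> (finite A \<or> finite (\<Omega> - A))}| \<le>o |\<Omega>|"
proof -
  have "A \<in> Fpow \<Omega> \<union> (\<lambda>A. \<Omega> - A) ` Fpow \<Omega>" if "A \<subseteq> \<Omega>" "finite A \<or> finite (\<Omega> - A)" for A
  proof (cases "finite A")
    case False
    then have "A = \<Omega> - (\<Omega> - A)" "\<Omega> - A \<in> Fpow \<Omega>" using that by (auto simp: Fpow_def)
    then show ?thesis by blast
  qed (use that in \<open>simp add: Fpow_def\<close>)
  then have "|{A. A \<subseteq> \<Omega> \<and> (finite A \<or> finite (\<Omega> - A))}| \<le>o |Fpow \<Omega> \<union> (\<lambda>A. \<Omega> - A) ` Fpow \<Omega>|"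
    by (intro card_of_mono1) blast
  also have "|Fpow \<Omega> \<union> (\<lambda>A. \<Omega> - A) ` Fpow \<Omega>| \<le>o |\<Omega>|"
  proof (rule card_of_Un_ordLeq_infinite_Field)
    show "|Fpow \<Omega>| \<le>o |\<Omega>|" by (rule card_of_Fpow_infinite[OF inf])
    with card_of_image[of "\<lambda>A. \<Omega> - A" "Fpow \<Omega>"]
    show "|(\<lambda>A. \<Omega> - A) ` Fpow \<Omega>| \<le>o |\<Omega>|" by (rule ordLeq_transitive)
    show "Card_order |\<Omega>|" by (rule card_of_Card_order)
  qed (use inf in \<open>simp add: Field_card_of\<close>)
  finally show ?thesis .
qed

text \<open>\<open>cardSuc \<kappa>\<close> lives on a type of sets, over which the property is
  stated; \<open>SVM_property_any_type\<close> moves it to the type of the algebra at hand.\<close>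

lemma SVM_property_approximation:
  fixes \<nu> :: "'p set \<Rightarrow> 'x::real_normed_vector"
  assumes SVM: "SVM_property (cardSuc \<kappa>) TYPE('x)" and \<kappa>: "Card_order \<kappa>"
    and F: "algebra \<Omega> F" "|F| \<le>o \<kappa>"
    and \<nu>: "\<And>A B. A \<in> F \<Longrightarrow> B \<in> F \<Longrightarrow> A \<inter> B = {} \<Longrightarrow> norm (\<nu> (A \<union> B) - \<nu> A - \<nu> B) \<le> 1"
  obtains \<mu> v where "Measure_Space.additive F \<mu>" "\<And>A. A \<in> F \<Longrightarrow> norm (\<nu> A - \<mu> A) \<le> v"
proof -
  obtain v where "SVM_property_with v (cardSuc \<kappa>) TYPE('p) TYPE('x)"
    using SVM SVM_property_any_type unfolding SVM_property_def by blast
  moreover have "|F| <o cardSuc \<kappa>"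
    using F(2) cardSuc_ordLeq_ordLess[OF \<kappa> card_of_Card_order] by blast
  ultimately have "\<exists>\<mu>. Measure_Space.additive F \<mu> \<and> (\<forall>A\<in>F. norm (\<nu> A - \<mu> A) \<le> v)"
    using F(1) \<nu> unfolding SVM_property_with_def by blast
  then show ?thesis using that by blast
qed

text \<open>
  A set function on the finite sets extends to the cofinite ones by \<open>A \<mapsto> - \<nu> (\<Omega> - A)\<close> with the
  same defect, because the complement of a cofinite \<open>B\<close> is the disjoint union of \<open>A\<close> and the complement
  of \<open>A \<union> B\<close> if \<open>A\<close> and \<open>B\<close> are disjoint.
\<close>

lemma finite_sets_approximation:
  fixes \<Gamma> :: "'i rel" and \<nu> :: "'i set \<Rightarrow> 'x::real_normed_vector"
  assumes \<Gamma>: "Card_order \<Gamma>" and SVM: "SVM_property (cardSuc \<Gamma>) TYPE('x)"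
    and \<nu>: "\<And>A B. A \<in> Fpow (Field \<Gamma>) \<Longrightarrow> B \<in> Fpow (Field \<Gamma>) \<Longrightarrow> A \<inter> B = {} \<Longrightarrow>
      norm (\<nu> (A \<union> B) - \<nu> A - \<nu> B) \<le> 1"
  shows "\<exists>\<mu> v. Measure_Space.additive (Fpow (Field \<Gamma>)) \<mu> \<and>
    (\<forall>A\<in>Fpow (Field \<Gamma>). norm (\<nu> A - \<mu> A) \<le> v)"
proof (cases "finite (Field \<Gamma>)")
  \<comment> \<open>For finite \<Gamma> there are more subsets than the property allows. A finite
    family of values is bounded, however, so the zero measure is near \<open>\<nu>\<close>, with
    \<open>v\<close> depending on \<open>\<nu>\<close>.\<close>
  case True
  then have "finite (Fpow (Field \<Gamma>))" by (simp add: Fpow_def)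
  then have "norm (\<nu> A - 0) \<le> (\<Sum>A\<in>Fpow (Field \<Gamma>). norm (\<nu> A))" if "A \<in> Fpow (Field \<Gamma>)" for A
    using that by (auto intro: member_le_sum)
  then show ?thesis
    by (intro exI[of _ "\<lambda>_. 0"] exI[of _ "\<Sum>A\<in>Fpow (Field \<Gamma>). norm (\<nu> A)"])
      (auto simp: Measure_Space.additive_def)
next
  case False
  define \<Omega> where "\<Omega> = Field \<Gamma>"
  define F where "F = {A. A \<subseteq> \<Omega> \<and> (finite A \<or> finite (\<Omega> - A))}"
  define \<nu>' where "\<nu>' A = (if finite A then \<nu> A else - \<nu> (\<Omega> - A))" for A
  have mixed: "norm (\<nu>' (A \<union> B) - \<nu>' A - \<nu>' B) \<le> 1"
    if A: "A \<subseteq> \<Omega>" "finite A" and B: "B \<subseteq> \<Omega>" "infinite B" "finite (\<Omega> - B)" and AB: "A \<inter> B = {}"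
    for A B
  proof -
    define C where "C = \<Omega> - (A \<union> B)"
    have C: "C \<in> Fpow \<Omega>" "A \<in> Fpow \<Omega>" "A \<inter> C = {}"
      using A B finite_subset[of C "\<Omega> - B"] by (auto simp: C_def Fpow_def)
    have "\<Omega> - B = A \<union> C" using A AB by (auto simp: C_def)
    then have "\<nu>' (A \<union> B) - \<nu>' A - \<nu>' B = \<nu> (A \<union> C) - \<nu> A - \<nu> C"
      using A B by (simp add: \<nu>'_def C_def)
    then show ?thesis using \<nu>[folded \<Omega>_def, OF C(2,1,3)] by simp
  qed
  have "norm (\<nu>' (A \<union> B) - \<nu>' A - \<nu>' B) \<le> 1" if AB: "A \<in> F" "B \<in> F" "A \<inter> B = {}" for A B
  proof -
    have ABF: "A \<subseteq> \<Omega>" "B \<subseteq> \<Omega>" "finite A \<or> finite (\<Omega> - A)" "finite B \<or> finite (\<Omega> - B)"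
      using AB by (auto simp: F_def)
    show ?thesis
    proof (cases "finite A"; cases "finite B")
      assume "finite A" "finite B"
      then show ?thesis using \<nu>[of A B] ABF AB(3) by (simp add: \<nu>'_def Fpow_def \<Omega>_def)
    next
      assume "finite A" "infinite B"
      then show ?thesis using mixed[of A B] ABF AB(3) by simp
    next
      assume "infinite A" "finite B"
      then have "norm (\<nu>' (B \<union> A) - \<nu>' B - \<nu>' A) \<le> 1" using mixed[of B A] ABF AB(3) by auto
      then show ?thesis by (simp add: Un_commute diff_diff_eq add.commute)
    next
      assume "infinite A" "infinite B"
      \<comment> \<open>This case is void: the infinite set \<open>A\<close> would lie in the finite
        complement of \<open>B\<close>.\<close>
      moreover have "A \<subseteq> \<Omega> - B" using ABF AB(3) by auto
      ultimately show ?thesis using ABF(4) finite_subset by blast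
    qed
  qed
  moreover have "|F| \<le>o \<Gamma>"
    using card_of_finite_cofinite[OF False] card_of_Field_ordIso[OF \<Gamma>] ordLeq_ordIso_trans
    unfolding F_def \<Omega>_def by blast
  moreover have "algebra \<Omega> F" unfolding F_def by (rule algebra_finite_cofinite)
  ultimately obtain \<mu> v where \<mu>: "Measure_Space.additive F \<mu>"
    and v: "\<And>A. A \<in> F \<Longrightarrow> norm (\<nu>' A - \<mu> A) \<le> v"
    by (metis SVM_property_approximation[OF SVM \<Gamma>])
  have sub: "Fpow (Field \<Gamma>) \<subseteq> F" by (auto simp: F_def \<Omega>_def Fpow_def)
  have "Measure_Space.additive (Fpow (Field \<Gamma>)) \<mu>"
    using \<mu> sub unfolding Measure_Space.additive_def by blast
  moreover have "norm (\<nu> A - \<mu> A) \<le> v" if "A \<in> Fpow (Field \<Gamma>)" for A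
    using v[of A] sub that by (auto simp: \<nu>'_def Fpow_def)
  ultimately show ?thesis by blast
qed

text \<open>The property counts the members of the algebra, not its points, whence the power of
  two.\<close>

lemma all_sets_approximation:
  fixes \<Gamma> :: "'i rel" and \<nu> :: "'i set \<Rightarrow> 'x::real_normed_vector"
  assumes SVM: "SVM_property (cardSuc (ctwo ^c \<Gamma>)) TYPE('x)"
    and \<nu>: "\<And>A B. A \<in> Pow (Field \<Gamma>) \<Longrightarrow> B \<in> Pow (Field \<Gamma>) \<Longrightarrow> A \<inter> B = {} \<Longrightarrow>
      norm (\<nu> (A \<union> B) - \<nu> A - \<nu> B) \<le> 1"
  shows "\<exists>\<mu> v. Measure_Space.additive (Pow (Field \<Gamma>)) \<mu> \<and>
    (\<forall>A\<in>Pow (Field \<Gamma>). norm (\<nu> A - \<mu> A) \<le> v)"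
proof -
  have "|Pow (Field \<Gamma>)| =o ctwo ^c \<Gamma>"
    unfolding ctwo_def cexp_def Field_card_of by (rule card_of_Pow_Func)
  then have "|Pow (Field \<Gamma>)| \<le>o ctwo ^c \<Gamma>" by (rule ordIso_imp_ordLeq)
  moreover have "algebra (Field \<Gamma>) (Pow (Field \<Gamma>))" by (simp add: algebra_iff_Un)
  ultimately show ?thesis
    using SVM_property_approximation[OF SVM Card_order_cexp, of "Field \<Gamma>" "Pow (Field \<Gamma>)" \<nu>] \<nu>
    by metis
qed

theorem theorem4p2:
  fixes \<Gamma> :: "'i rel"
  assumes "Card_order \<Gamma>"
  shows "(SVM_property (cardSuc (ctwo ^c \<Gamma>)) TYPE('x::banach) \<longrightarrow>
            pair_splits (linf (Field \<Gamma>)) TYPE('x) TYPE('z::f_space)) \<and>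
         (SVM_property (cardSuc \<Gamma>) TYPE('x) \<longrightarrow>
            pair_splits (c0 (Field \<Gamma>)) TYPE('x) TYPE('z))"
proof (intro conjI impI)
  assume SVM: "SVM_property (cardSuc (ctwo ^c \<Gamma>)) TYPE('x)"
  show "pair_splits (linf (Field \<Gamma>)) TYPE('x) TYPE('z)"
    using pair_splits_level_space[OF set_ideal_Pow _ all_sets_approximation[OF SVM]]
    by (simp add: level_space_Pow subspace_linf)
next
  assume SVM: "SVM_property (cardSuc \<Gamma>) TYPE('x)"
  show "pair_splits (c0 (Field \<Gamma>)) TYPE('x) TYPE('z)"
    using pair_splits_level_space[OF set_ideal_Fpow _ finite_sets_approximation[OF assms SVM]]
    by (simp add: level_space_Fpow subspace_c0)
qed

end
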